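(* For a discrete memoryless two-user interference channel with generalized feedback (IC-GF) with transition probability $p(y_1,y_2,y_{F_1},y_{F_2}|x_1,x_2)$, the capacity region is contained in the region $\mathcal{DB}^{IC}$, defined as the set (union over all admissible distributions) of all pairs $(R_1,R_2)$ of nonnegative reals for which there exist random variables $(T_1,T_2,X_1,X_2,Y_1,Y_2,Y_{F_1},Y_{F_2})$ with $$R_1\le I(X_1,X_2;Y_1),\qquad R_2\le I(X_1,X_2;Y_2),$$ $$R_1\le I(X_1;Y_1,Y_2,Y_{F_2}|X_2,T_2),\qquad R_2\le I(X_2;Y_1,Y_2,Y_{F_1}|X_1,T_1),$$ $$R_1+R_2\le I(X_1,X_2;Y_1,Y_2,Y_{F_1},Y_{F_2}|T_1,T_2),\qquad R_1+R_2\le I(X_1,X_2;Y_1,Y_2),$$ whose joint distribution has the form $$p(t_1,t_2,x_1,x_2,y_1,y_2,y_{F_1},y_{F_2})=p(t_1,t_2,x_1,x_2)\,p(y_1,y_2,y_{F_1},y_{F_2}|x_1,x_2),$$ and which satisfy the dependence balance bound $$I(X_1;X_2|T_1,T_2)\le I(X_1;X_2|Y_{F_1},Y_{F_2},T_1,T_2).$$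
   Context: A discrete memoryless IC-GF consists of finite input alphabets $\mathcal X_1,\mathcal X_2$, finite output alphabets $\mathcal Y_1,\mathcal Y_2$ at receivers 1 and 2, finite feedback alphabets $\mathcal Y_{F_1},\mathcal Y_{F_2}$ at transmitters 1 and 2, and a transition probability $p(y_1,y_2,y_{F_1},y_{F_2}|x_1,x_2)$, used memorylessly. An $(n,M_1,M_2,P_e^{(1)},P_e^{(2)})$ code consists of encoding functions $f_{ki}:\{1,\dots,M_k\}\times\mathcal Y_{F_k}^{i-1}\to\mathcal X_k$, $k=1,2$, $i=1,\dots,n$ (so $X_{ki}=f_{ki}(W_k,Y_{F_k}^{i-1})$), and decoders $g_k:\mathcal Y_k^n\to\{1,\dots,M_k\}$, $k=1,2$. The messages $W_1,W_2$ are independent and uniform on $\{1,\dots,M_1\}$, $\{1,\dots,M_2\}$, and $P_e^{(k)}=\Pr[\hat W_k\ne W_k]$ with $\hat W_k=g_k(Y_k^n)$. A pair $(R_1,R_2)$ of nonnegative reals is achievable if for all $\epsilon_1,\epsilon_2>0$ and all sufficiently large $n$ there is a code with $R_k\le\log(M_k)/n$ and $P_e^{(k)}\le\epsilon_k$ for $k=1,2$. The capacity region is the closure of the set of achievable pairs. $T_1,T_2$ are auxiliary random variables with arbitrary alphabets. *)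

theory Defs
  imports "HOL-Probability.Probability"
begin

text \<open>
  Finite alphabets are types of class finite. A channel maps an input pair to the joint law of
  (output at receiver 1, output at receiver 2, feedback to transmitter 1, feedback to
  transmitter 2). All logarithms are to base 2.
\<close>

type_synonym ('x1, 'x2, 'y1, 'y2, 'f1, 'f2) icgf =
  "'x1 \<Rightarrow> 'x2 \<Rightarrow> ('y1 \<times> 'y2 \<times> 'f1 \<times> 'f2) pmf"

text \<open>
  The encoders take the time index \<open>i \<ge> 1\<close>, the message, and the list of the \<open>i - 1\<close> feedback
  symbols received so far, oldest first.
\<close>

record ('x1, 'x2, 'y1, 'y2, 'f1, 'f2) ic_code =
  enc1 :: "nat \<Rightarrow> nat \<Rightarrow> 'f1 list \<Rightarrow> 'x1"
  enc2 :: "nat \<Rightarrow> nat \<Rightarrow> 'f2 list \<Rightarrow> 'x2"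
  dec1 :: "'y1 list \<Rightarrow> nat"
  dec2 :: "'y2 list \<Rightarrow> nat"

definition out1 :: "'y1 \<times> 'y2 \<times> 'f1 \<times> 'f2 \<Rightarrow> 'y1" where
  "out1 = (\<lambda>(y1, y2, f1, f2). y1)"

definition out2 :: "'y1 \<times> 'y2 \<times> 'f1 \<times> 'f2 \<Rightarrow> 'y2" where
  "out2 = (\<lambda>(y1, y2, f1, f2). y2)"

definition fb1 :: "'y1 \<times> 'y2 \<times> 'f1 \<times> 'f2 \<Rightarrow> 'f1" where
  "fb1 = (\<lambda>(y1, y2, f1, f2). f1)"

definition fb2 :: "'y1 \<times> 'y2 \<times> 'f1 \<times> 'f2 \<Rightarrow> 'f2" where
  "fb2 = (\<lambda>(y1, y2, f1, f2). f2)"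

text \<open>Law of the channel outputs of the first \<open>n\<close> uses, given the messages.\<close>

primrec outputs_pmf ::
  "('x1, 'x2, 'y1, 'y2, 'f1, 'f2) icgf \<Rightarrow> ('x1, 'x2, 'y1, 'y2, 'f1, 'f2) ic_code \<Rightarrow>
   nat \<Rightarrow> nat \<Rightarrow> nat \<Rightarrow> ('y1 \<times> 'y2 \<times> 'f1 \<times> 'f2) list pmf" where
  "outputs_pmf ch c w1 w2 0 = return_pmf []"
| "outputs_pmf ch c w1 w2 (Suc n) =
    bind_pmf (outputs_pmf ch c w1 w2 n) (\<lambda>h.
      map_pmf (\<lambda>z. h @ [z])
        (ch (enc1 c (Suc n) w1 (map fb1 h)) (enc2 c (Suc n) w2 (map fb2 h))))"

definition code_pmf ::
  "('x1, 'x2, 'y1, 'y2, 'f1, 'f2) icgf \<Rightarrow> ('x1, 'x2, 'y1, 'y2, 'f1, 'f2) ic_code \<Rightarrow>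
   nat \<Rightarrow> nat \<Rightarrow> nat \<Rightarrow> ((nat \<times> nat) \<times> ('y1 \<times> 'y2 \<times> 'f1 \<times> 'f2) list) pmf" where
  "code_pmf ch c n M1 M2 =
    bind_pmf (pair_pmf (pmf_of_set {1..M1}) (pmf_of_set {1..M2})) (\<lambda>(w1, w2).
      map_pmf (\<lambda>h. ((w1, w2), h)) (outputs_pmf ch c w1 w2 n))"

definition is_code ::
  "('x1, 'x2, 'y1, 'y2, 'f1, 'f2) icgf \<Rightarrow> nat \<Rightarrow> nat \<Rightarrow> nat \<Rightarrow> real \<Rightarrow> real \<Rightarrow>
   ('x1, 'x2, 'y1, 'y2, 'f1, 'f2) ic_code \<Rightarrow> bool" where
  "is_code ch n M1 M2 P1 P2 c \<longleftrightarrow>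
    1 \<le> M1 \<and> 1 \<le> M2 \<and>
    (\<forall>ys. length ys = n \<longrightarrow> dec1 c ys \<in> {1..M1}) \<and>
    (\<forall>ys. length ys = n \<longrightarrow> dec2 c ys \<in> {1..M2}) \<and>
    P1 = measure_pmf.prob (code_pmf ch c n M1 M2) {((w1, w2), h). dec1 c (map out1 h) \<noteq> w1} \<and>
    P2 = measure_pmf.prob (code_pmf ch c n M1 M2) {((w1, w2), h). dec2 c (map out2 h) \<noteq> w2}"

definition achievable ::
  "('x1, 'x2, 'y1, 'y2, 'f1, 'f2) icgf \<Rightarrow> real \<Rightarrow> real \<Rightarrow> bool" where
  "achievable ch R1 R2 \<longleftrightarrow>
    0 \<le> R1 \<and> 0 \<le> R2 \<and>
    (\<forall>\<epsilon>1>0. \<forall>\<epsilon>2>0. \<forall>\<^sub>F n in sequentially.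
      \<exists>M1 M2 P1 P2 c. is_code ch n M1 M2 P1 P2 c \<and>
        R1 \<le> log 2 (real M1) / real n \<and> R2 \<le> log 2 (real M2) / real n \<and>
        P1 \<le> \<epsilon>1 \<and> P2 \<le> \<epsilon>2)"

definition capacity_region ::
  "('x1, 'x2, 'y1, 'y2, 'f1, 'f2) icgf \<Rightarrow> (real \<times> real) set" where
  "capacity_region ch = closure {(R1, R2). achievable ch R1 R2}"

text \<open>
  Mutual informations in which the first variable (and, in the conditional case, the second) has a
  finite alphabet; the conditioning variable takes values in an arbitrary measurable space. The
  library's conditional mutual information is the difference \<open>I(X; Y, Z) - I(X; Z)\<close>, and both terms
  are finite when \<open>X\<close> has a finite alphabet, so no densities with respect to a reference measure
  on the alphabet of \<open>Z\<close> are needed.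
\<close>

definition mi :: "'w measure \<Rightarrow> ('w \<Rightarrow> 'a::finite) \<Rightarrow> ('w \<Rightarrow> 'b::finite) \<Rightarrow> real" where
  "mi M X Y = prob_space.mutual_information M 2 (count_space UNIV) (count_space UNIV) X Y"

definition cmi ::
  "'w measure \<Rightarrow> 'c measure \<Rightarrow> ('w \<Rightarrow> 'a::finite) \<Rightarrow> ('w \<Rightarrow> 'b::finite) \<Rightarrow> ('w \<Rightarrow> 'c) \<Rightarrow> real" where
  "cmi M S X Y Z =
    prob_space.conditional_mutual_information M 2 (count_space UNIV) (count_space UNIV) S X Y Z"

text \<open>
  Random variables on the probability space \<open>M\<close>, with the auxiliary variables \<open>T1\<close>, \<open>T2\<close> taking
  values in the measurable spaces \<open>S1\<close>, \<open>S2\<close>, whose joint law is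
  \<open>p(t1,t2,x1,x2) p(y1,y2,f1,f2|x1,x2)\<close>.
\<close>

definition channel_variables ::
  "('x1::finite, 'x2::finite, 'y1::finite, 'y2::finite, 'f1::finite, 'f2::finite) icgf \<Rightarrow>
   'w measure \<Rightarrow> 't1 measure \<Rightarrow> 't2 measure \<Rightarrow> ('w \<Rightarrow> 't1) \<Rightarrow> ('w \<Rightarrow> 't2) \<Rightarrow>
   ('w \<Rightarrow> 'x1) \<Rightarrow> ('w \<Rightarrow> 'x2) \<Rightarrow> ('w \<Rightarrow> 'y1) \<Rightarrow> ('w \<Rightarrow> 'y2) \<Rightarrow>
   ('w \<Rightarrow> 'f1) \<Rightarrow> ('w \<Rightarrow> 'f2) \<Rightarrow> bool" where
  "channel_variables ch M S1 S2 T1 T2 X1 X2 Y1 Y2 F1 F2 \<longleftrightarrow>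
    prob_space M \<and>
    T1 \<in> measurable M S1 \<and> T2 \<in> measurable M S2 \<and>
    X1 \<in> measurable M (count_space UNIV) \<and> X2 \<in> measurable M (count_space UNIV) \<and>
    Y1 \<in> measurable M (count_space UNIV) \<and> Y2 \<in> measurable M (count_space UNIV) \<and>
    F1 \<in> measurable M (count_space UNIV) \<and> F2 \<in> measurable M (count_space UNIV) \<and>
    (\<forall>A \<in> sets (S1 \<Otimes>\<^sub>M S2). \<forall>x1 x2 y1 y2 f1 f2.
      measure M {\<omega> \<in> space M. (T1 \<omega>, T2 \<omega>) \<in> A \<and> X1 \<omega> = x1 \<and> X2 \<omega> = x2 \<and>
                              Y1 \<omega> = y1 \<and> Y2 \<omega> = y2 \<and> F1 \<omega> = f1 \<and> F2 \<omega> = f2} =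
      measure M {\<omega> \<in> space M. (T1 \<omega>, T2 \<omega>) \<in> A \<and> X1 \<omega> = x1 \<and> X2 \<omega> = x2} *
      pmf (ch x1 x2) (y1, y2, f1, f2))"

text \<open>
  HOL cannot quantify over types inside a formula, so the alphabets \<open>S1\<close>, \<open>S2\<close> of the auxiliary
  variables range over all measurable spaces carried by sets of reals (with any sigma-algebra, not
  only the Borel one). This includes all finite and countable alphabets and, up to
  isomorphism, all standard Borel ones; the sample space is a type large enough to carry the
  joint law. Since the region is a union over auxiliary variables, restricting their carrier can
  only make it smaller, i.e. the outer bound stronger.
\<close>

definition DB_IC ::
  "('x1::finite, 'x2::finite, 'y1::finite, 'y2::finite, 'f1::finite, 'f2::finite) icgf \<Rightarrow>
   (real \<times> real) set" where
  "DB_IC ch = {(R1, R2). 0 \<le> R1 \<and> 0 \<le> R2 \<and>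
    (\<exists>(M :: (real \<times> real \<times> 'x1 \<times> 'x2 \<times> 'y1 \<times> 'y2 \<times> 'f1 \<times> 'f2) measure)
      (S1 :: real measure) (S2 :: real measure) T1 T2 X1 X2 Y1 Y2 F1 F2.
      channel_variables ch M S1 S2 T1 T2 X1 X2 Y1 Y2 F1 F2 \<and>
      R1 \<le> mi M (\<lambda>\<omega>. (X1 \<omega>, X2 \<omega>)) Y1 \<and>
      R2 \<le> mi M (\<lambda>\<omega>. (X1 \<omega>, X2 \<omega>)) Y2 \<and>
      R1 \<le> cmi M (count_space UNIV \<Otimes>\<^sub>M S2) X1 (\<lambda>\<omega>. (Y1 \<omega>, Y2 \<omega>, F2 \<omega>)) (\<lambda>\<omega>. (X2 \<omega>, T2 \<omega>)) \<and>
      R2 \<le> cmi M (count_space UNIV \<Otimes>\<^sub>M S1) X2 (\<lambda>\<omega>. (Y1 \<omega>, Y2 \<omega>, F1 \<omega>)) (\<lambda>\<omega>. (X1 \<omega>, T1 \<omega>)) \<and>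
      R1 + R2 \<le> cmi M (S1 \<Otimes>\<^sub>M S2) (\<lambda>\<omega>. (X1 \<omega>, X2 \<omega>)) (\<lambda>\<omega>. (Y1 \<omega>, Y2 \<omega>, F1 \<omega>, F2 \<omega>))
                  (\<lambda>\<omega>. (T1 \<omega>, T2 \<omega>)) \<and>
      R1 + R2 \<le> mi M (\<lambda>\<omega>. (X1 \<omega>, X2 \<omega>)) (\<lambda>\<omega>. (Y1 \<omega>, Y2 \<omega>)) \<and>
      cmi M (S1 \<Otimes>\<^sub>M S2) X1 X2 (\<lambda>\<omega>. (T1 \<omega>, T2 \<omega>)) \<le>
        cmi M (count_space UNIV \<Otimes>\<^sub>M (count_space UNIV \<Otimes>\<^sub>M (S1 \<Otimes>\<^sub>M S2))) X1 X2
          (\<lambda>\<omega>. (F1 \<omega>, F2 \<omega>, T1 \<omega>, T2 \<omega>)))}"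

end

theory Submission
  imports Defs "HOL-Real_Asymp.Real_Asymp"
begin

text \<open>
  The auxiliary variables can hide information by a one-time pad. If \<open>C\<close> takes values in
  \<open>\<int>/N\<close> and \<open>U\<close> is uniform and independent of everything, then \<open>T1 = U\<close> and
  \<open>T2 = C + U\<close> are each independent of all channel variables, while the pair \<open>(T1, T2)\<close>
  reveals \<open>C\<close>. So it suffices to find a finitely valued \<open>C\<close> for which the rate bounds given
  \<open>T1\<close> or \<open>T2\<close> alone hold unconditionally, and the sum bound and the dependence balance
  bound hold given \<open>C\<close>.

  The unconditional bounds depend only on the law of the channel inputs, and the other two are
  averages over \<open>C\<close> of continuous functions of the conditional input law. The attainable triples
  (input law, averaged sum bound, averaged balance) therefore form the convex hull of a compact
  set, which is compact, and bounds that hold up to every \<open>\<delta> > 0\<close> hold exactly at some point.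
  For a code of length \<open>n\<close>, Fano's inequality and the chain rule give the bounds up to a
  vanishing error, with \<open>C\<close> consisting of a uniformly chosen instant \<open>i\<close> and the feedback
  received by both transmitters before \<open>i\<close>; the balance telescopes to
  \<open>I(W1; W2 | F1\<^sup>n, F2\<^sup>n) - I(W1; W2) \<ge> 0\<close>.
\<close>

subsection \<open>Entropy of random variables on finitely supported spaces\<close>

abbreviation pmf_E :: "'a pmf \<Rightarrow> ('a \<Rightarrow> real) \<Rightarrow> real" where
  "pmf_E p f \<equiv> measure_pmf.expectation p f"

text \<open>Entropy in bits as expected surprisal. The range type is unconstrained, so messages and
  feedback lists fit directly; finiteness is asked of the support instead.\<close>

definition ent :: "'w pmf \<Rightarrow> ('w \<Rightarrow> 'a) \<Rightarrow> real" where
  "ent p X = pmf_E p (\<lambda>w. - log 2 (pmf (map_pmf X p) (X w)))"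

text \<open>The chain rule serves as the definition, so chain-rule steps reduce to regrouping
  tuples.\<close>

definition cent :: "'w pmf \<Rightarrow> ('w \<Rightarrow> 'a) \<Rightarrow> ('w \<Rightarrow> 'b) \<Rightarrow> real" where
  "cent p X Y = ent p (\<lambda>w. (X w, Y w)) - ent p Y"

lemma pmf_E_finite:
  assumes "finite (set_pmf p)"
  shows "pmf_E p f = (\<Sum>w\<in>set_pmf p. pmf p w * f w)"
  using integral_measure_pmf[OF assms, of p f] by simp

lemma pmf_E_mono:
  assumes "finite (set_pmf p)" "\<And>w. w \<in> set_pmf p \<Longrightarrow> f w \<le> g w"
  shows "pmf_E p f \<le> pmf_E p g"
  using assms by (auto simp: pmf_E_finite intro!: sum_mono mult_left_mono)

lemma pmf_E_cong:
  assumes "\<And>w. w \<in> set_pmf p \<Longrightarrow> f w = g w"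
  shows "pmf_E p f = pmf_E p g"
  using assms by (intro integral_cong_AE) (auto simp: AE_measure_pmf_iff)

lemma pmf_E_diff:
  assumes "finite (set_pmf p)"
  shows "pmf_E p (\<lambda>w. f w - g w) = pmf_E p f - pmf_E p g"
  using assms by (simp add: pmf_E_finite algebra_simps sum_subtractf)

lemma pmf_E_add:
  assumes "finite (set_pmf p)"
  shows "pmf_E p (\<lambda>w. f w + g w) = pmf_E p f + pmf_E p g"
  using assms by (simp add: pmf_E_finite algebra_simps sum.distrib)

lemma pmf_E_bind:
  assumes "finite (set_pmf p)" "\<And>x. x \<in> set_pmf p \<Longrightarrow> finite (set_pmf (k x))"
  shows "pmf_E (bind_pmf p k) f = pmf_E p (\<lambda>x. pmf_E (k x) f)"
  using assms by (simp add: pmf_expectation_bind[of "set_pmf p"] pmf_E_finite[OF assms(1)])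

lemma ent_map: "ent (map_pmf f p) X = ent p (\<lambda>w. X (f w))"
  by (simp add: ent_def map_pmf_comp o_def)

lemma cent_map: "cent (map_pmf f p) X Y = cent p (\<lambda>w. X (f w)) (\<lambda>w. Y (f w))"
  by (simp add: cent_def ent_map)

lemma pmf_map_pos: "w \<in> set_pmf p \<Longrightarrow> 0 < pmf (map_pmf X p) (X w)"
  by (auto simp: pmf_positive_iff)

lemma pmf_map_eq_prob: "pmf (map_pmf X p) (X w) = measure_pmf.prob p {w'. X w' = X w}"
  by (simp add: pmf_map vimage_def)

text \<open>Entropy depends only on the partition that a variable induces on the support. Permuting,
  regrouping and duplicating components of tuples rests on this.\<close>

lemma ent_eqI:
  assumes "\<And>w w'. w \<in> set_pmf p \<Longrightarrow> w' \<in> set_pmf p \<Longrightarrow> X w = X w' \<longleftrightarrow> Y w = Y w'"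
  shows "ent p X = ent p Y"
  unfolding ent_def pmf_map_eq_prob
proof (intro pmf_E_cong arg_cong[where f="\<lambda>t. - log 2 t"])
  fix w assume "w \<in> set_pmf p"
  then show "measure_pmf.prob p {w'. X w' = X w} = measure_pmf.prob p {w'. Y w' = Y w}"
    using assms by (intro measure_pmf.finite_measure_eq_AE) (auto simp: AE_measure_pmf_iff)
qed

lemma cent_eqI:
  assumes "\<And>w w'. w \<in> set_pmf p \<Longrightarrow> w' \<in> set_pmf p \<Longrightarrow>
      Y w = Y w' \<longleftrightarrow> Y' w = Y' w'"
    and "\<And>w w'. w \<in> set_pmf p \<Longrightarrow> w' \<in> set_pmf p \<Longrightarrow> Y w = Y w' \<Longrightarrow>
      X w = X w' \<longleftrightarrow> X' w = X' w'"
  shows "cent p X Y = cent p X' Y'"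
proof -
  have "ent p (\<lambda>w. (X w, Y w)) = ent p (\<lambda>w. (X' w, Y' w))"
    by (rule ent_eqI) (use assms in auto)
  moreover have "ent p Y = ent p Y'"
    by (rule ent_eqI) (use assms in auto)
  ultimately show ?thesis by (simp add: cent_def)
qed

lemma ent_const [simp]: "ent p (\<lambda>_. c) = 0"
  by (simp add: ent_def)

lemma cent_const: "cent p X (\<lambda>_. c) = ent p X"
proof -
  have "ent p (\<lambda>w. (X w, c)) = ent p X" by (rule ent_eqI) auto
  then show ?thesis by (simp add: cent_def)
qed

lemma cent_eq_E:
  assumes "finite (set_pmf p)"
  shows "cent p X Y = pmf_E p (\<lambda>w. - log 2 (pmf (map_pmf (\<lambda>w. (X w, Y w)) p) (X w, Y w)
            / pmf (map_pmf Y p) (Y w)))"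
proof -
  have "cent p X Y = pmf_E p (\<lambda>w. - log 2 (pmf (map_pmf (\<lambda>w. (X w, Y w)) p) (X w, Y w))
      - - log 2 (pmf (map_pmf Y p) (Y w)))"
    unfolding cent_def ent_def using assms by (rule pmf_E_diff[symmetric])
  also have "\<dots> = pmf_E p (\<lambda>w. - log 2 (pmf (map_pmf (\<lambda>w. (X w, Y w)) p) (X w, Y w)
            / pmf (map_pmf Y p) (Y w)))"
  proof (rule pmf_E_cong)
    fix w assume "w \<in> set_pmf p"
    then have "0 < pmf (map_pmf (\<lambda>w. (X w, Y w)) p) (X w, Y w)" "0 < pmf (map_pmf Y p) (Y w)"
      using pmf_map_pos[of w p "\<lambda>w. (X w, Y w)"] pmf_map_pos[of w p Y] by auto
    then show "- log 2 (pmf (map_pmf (\<lambda>w. (X w, Y w)) p) (X w, Y w)) - - log 2 (pmf (map_pmf Y p) (Y w))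
      = - log 2 (pmf (map_pmf (\<lambda>w. (X w, Y w)) p) (X w, Y w) / pmf (map_pmf Y p) (Y w))"
      by (simp add: log_divide)
  qed
  finally show ?thesis .
qed

text \<open>Gibbs' inequality for a sub-probability kernel \<open>q\<close>, from ln t \<le> t - 1.
  In \<open>cent_mono\<close> the kernel is a conditional law, in \<open>fano\<close> it encodes a
  guess.\<close>

lemma cent_le_cross_entropy:
  assumes fin: "finite (set_pmf p)"
    and pos: "\<And>w. w \<in> set_pmf p \<Longrightarrow> 0 < q (X w) (Y w)"
    and nn: "\<And>x y. 0 \<le> q x y"
    and sub: "\<And>w. w \<in> set_pmf p \<Longrightarrow> (\<Sum>x\<in>X ` set_pmf p. q x (Y w)) \<le> 1"
  shows "cent p X Y \<le> pmf_E p (\<lambda>w. - log 2 (q (X w) (Y w)))"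
proof -
  let ?XY = "map_pmf (\<lambda>w. (X w, Y w)) p" and ?Y = "map_pmf Y p" and ?S = "set_pmf p"
  \<comment> \<open>Likelihood ratio of q(x|y) p(y) to the true joint law. Its mean is at most 1
    because \<open>q\<close> has mass at most 1 for each attained y.\<close>
  let ?r = "\<lambda>(x, y). q x y * pmf ?Y y / pmf ?XY (x, y)"
  have pXY: "0 < pmf ?XY (X w, Y w)" and pY: "0 < pmf ?Y (Y w)" if "w \<in> ?S" for w
    using pmf_map_pos[OF that, of "\<lambda>w. (X w, Y w)"] pmf_map_pos[OF that, of Y] by auto
  have "pmf_E p (\<lambda>w. ?r (X w, Y w)) = pmf_E ?XY ?r"
    by (simp add: integral_map_pmf)
  also have "\<dots> = (\<Sum>v\<in>set_pmf ?XY. pmf ?XY v * ?r v)"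
    using fin by (intro pmf_E_finite) simp
  also have "\<dots> = (\<Sum>(x, y)\<in>set_pmf ?XY. q x y * pmf ?Y y)"
    using pXY by (intro sum.cong) (fastforce split: prod.splits)+
  also have "\<dots> \<le> (\<Sum>(x, y)\<in>X ` ?S \<times> Y ` ?S. q x y * pmf ?Y y)"
    using fin nn by (intro sum_mono2) auto
  also have "\<dots> = (\<Sum>y\<in>Y ` ?S. pmf ?Y y * (\<Sum>x\<in>X ` ?S. q x y))"
    by (simp add: sum.cartesian_product[symmetric] sum_distrib_left mult.commute)
       (subst sum.swap, simp)
  also have "\<dots> \<le> (\<Sum>y\<in>Y ` ?S. pmf ?Y y)"
    using sub by (intro sum_mono mult_left_le) auto
  also have "\<dots> = 1"
    using fin by (intro sum_pmf_eq_1) auto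
  finally have le1: "pmf_E p (\<lambda>w. ?r (X w, Y w)) \<le> 1" .
  have affine: "pmf_E p (\<lambda>w. c * h w - d) = c * pmf_E p h - d" for c d :: real and h
    using fin by (subst pmf_E_diff) auto
  have "cent p X Y - pmf_E p (\<lambda>w. - log 2 (q (X w) (Y w))) =
      pmf_E p (\<lambda>w. - log 2 (pmf ?XY (X w, Y w) / pmf ?Y (Y w)) - - log 2 (q (X w) (Y w)))"
    unfolding cent_eq_E[OF fin] using fin by (rule pmf_E_diff[symmetric])
  also have "\<dots> \<le> pmf_E p (\<lambda>w. (1 / ln 2) * ?r (X w, Y w) - 1 / ln 2)"
  proof (rule pmf_E_mono[OF fin])
    fix w assume w: "w \<in> ?S"
    let ?a = "pmf ?XY (X w, Y w)" and ?b = "pmf ?Y (Y w)" and ?c = "q (X w) (Y w)"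
    have p: "0 < ?a" "0 < ?b" "0 < ?c" using pXY[OF w] pY[OF w] pos[OF w] by auto
    have "- log 2 (?a / ?b) - - log 2 ?c = log 2 (?c * ?b / ?a)"
      using p by (simp add: log_divide log_mult)
    also have "\<dots> = ln (?c * ?b / ?a) / ln 2" by (simp add: log_def)
    also have "\<dots> \<le> (?c * ?b / ?a - 1) / ln 2"
      using p by (intro divide_right_mono ln_le_minus_one) auto
    finally show "- log 2 (?a / ?b) - - log 2 ?c \<le> (1 / ln 2) * ?r (X w, Y w) - 1 / ln 2"
      by (simp add: diff_divide_distrib mult.commute)
  qed
  also have "\<dots> = (1 / ln 2) * pmf_E p (\<lambda>w. ?r (X w, Y w)) - 1 / ln 2"
    by (rule affine)
  also have "\<dots> \<le> 0"
    using le1 by (simp add: divide_right_mono)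
  finally show ?thesis by simp
qed

text \<open>Conditioning on more lowers entropy: \<open>Z\<close> is a function of \<open>Y\<close>
  on the support, so the law of \<open>X\<close> given \<open>Z\<close> is an admissible kernel for
  predicting \<open>X\<close> from \<open>Y\<close>.\<close>

lemma cent_mono:
  assumes fin: "finite (set_pmf p)"
    and det: "\<And>w w'. w \<in> set_pmf p \<Longrightarrow> w' \<in> set_pmf p \<Longrightarrow> Y w = Y w' \<Longrightarrow> Z w = Z w'"
  shows "cent p X Y \<le> cent p X Z"
proof -
  let ?S = "set_pmf p"
  \<comment> \<open>Recovers \<open>Z\<close> from a representative of the fibre of
    \<open>Y\<close>; the value is arbitrary where the fibre misses the support.\<close>
  define k where "k y = Z (SOME w. w \<in> ?S \<and> Y w = y)" for y
  have k: "k (Y w) = Z w" if "w \<in> ?S" for w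
  proof -
    let ?w = "SOME w'. w' \<in> ?S \<and> Y w' = Y w"
    have "?w \<in> ?S \<and> Y ?w = Y w" by (rule someI[of _ w]) (use that in simp)
    then show ?thesis using det[of ?w w] that by (simp add: k_def)
  qed
  let ?XZ = "map_pmf (\<lambda>w. (X w, Z w)) p" and ?Z = "map_pmf Z p"
  define q where "q x y = pmf ?XZ (x, k y) / pmf ?Z (k y)" for x y
  have "cent p X Y \<le> pmf_E p (\<lambda>w. - log 2 (q (X w) (Y w)))"
  proof (rule cent_le_cross_entropy[OF fin])
    fix w assume w: "w \<in> ?S"
    show "0 < q (X w) (Y w)"
      using pmf_map_pos[OF w, of "\<lambda>w. (X w, Z w)"] pmf_map_pos[OF w, of Z] by (simp add: q_def k w)
    have "(\<Sum>x\<in>X ` ?S. pmf ?XZ (x, Z w)) = measure_pmf.prob ?XZ ((\<lambda>x. (x, Z w)) ` X ` ?S)"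
      using fin by (subst measure_measure_pmf_finite) (auto simp: sum.reindex inj_on_def)
    also have "\<dots> \<le> measure_pmf.prob p {w'. Z w' = Z w}"
      by (auto simp: measure_map_pmf intro!: measure_pmf.finite_measure_mono)
    also have "\<dots> = pmf ?Z (Z w)" by (simp add: pmf_map_eq_prob)
    finally show "(\<Sum>x\<in>X ` ?S. q x (Y w)) \<le> 1"
      using pmf_map_pos[OF w, of Z] by (simp add: q_def k w sum_divide_distrib[symmetric])
  qed (simp add: q_def)
  also have "\<dots> = cent p X Z"
    unfolding cent_eq_E[OF fin] by (rule pmf_E_cong) (simp add: q_def k)
  finally show ?thesis .
qed

lemma cent_le_ent:
  assumes "finite (set_pmf p)"
  shows "cent p X Y \<le> ent p X"
  using cent_mono[OF assms, of Y "\<lambda>_. ()" X] by (simp add: cent_const)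

lemma set_mix_finite:
  assumes "finite (set_pmf m)" "\<And>c. c \<in> set_pmf m \<Longrightarrow> finite (set_pmf (p c))"
  shows "finite (set_pmf (bind_pmf m (\<lambda>c. map_pmf (Pair c) (p c))))"
  using assms by auto

lemma pmf_map_mix:
  assumes "finite (set_pmf m)"
  shows "pmf (map_pmf (\<lambda>w. (X w, fst w)) (bind_pmf m (\<lambda>c. map_pmf (Pair c) (p c)))) (v, c)
       = pmf m c * pmf (map_pmf (\<lambda>w. X (c, w)) (p c)) v"
proof -
  have "pmf (map_pmf (\<lambda>w. (X w, fst w)) (bind_pmf m (\<lambda>c. map_pmf (Pair c) (p c)))) (v, c) =
     pmf_E m (\<lambda>d. pmf (map_pmf (\<lambda>w. (X (d, w), d)) (p d)) (v, c))"
    by (simp add: map_bind_pmf pmf_bind map_pmf_comp)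
  also have "\<dots> = pmf_E m (\<lambda>d. if d = c then pmf (map_pmf (\<lambda>w. X (c, w)) (p c)) v else 0)"
    by (intro pmf_E_cong) (auto simp: pmf_map vimage_def)
  also have "\<dots> = pmf m c * pmf (map_pmf (\<lambda>w. X (c, w)) (p c)) v"
    using assms by (simp add: pmf_E_finite if_distrib sum.delta set_pmf_iff cong: if_cong)
  finally show ?thesis .
qed

text \<open>The weight of the label cancels in the conditional probability, which leaves the
  surprisals under \<open>p c\<close>.\<close>

lemma cent_mix:
  assumes m: "finite (set_pmf m)" and p: "\<And>c. c \<in> set_pmf m \<Longrightarrow> finite (set_pmf (p c))"
  shows "cent (bind_pmf m (\<lambda>c. map_pmf (Pair c) (p c))) X fst = pmf_E m (\<lambda>c. ent (p c) (\<lambda>w. X (c, w)))"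
proof -
  let ?M = "bind_pmf m (\<lambda>c. map_pmf (Pair c) (p c))"
  have fst: "map_pmf fst ?M = m"
    by (simp add: map_bind_pmf map_pmf_comp bind_return_pmf')
  have fin: "finite (set_pmf ?M)" by (rule set_mix_finite) (use m p in auto)
  have "cent ?M X fst = pmf_E m (\<lambda>c. pmf_E (p c) (\<lambda>w.
     - log 2 (pmf m c * pmf (map_pmf (\<lambda>w. X (c, w)) (p c)) (X (c, w)) / pmf m c)))"
    unfolding cent_eq_E[OF fin] fst
    by (subst pmf_E_bind) (use m p in \<open>simp_all add: pmf_map_mix[OF m] cong: if_cong\<close>)
  also have "\<dots> = pmf_E m (\<lambda>c. ent (p c) (\<lambda>w. X (c, w)))"
    unfolding ent_def by (intro pmf_E_cong) (simp add: set_pmf_iff)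
  finally show ?thesis .
qed

section \<open>Uniform and independent variables, and Fano's inequality\<close>

lemma ent_pmf_of_set:
  assumes "finite A" "A \<noteq> {}"
  shows "ent (pmf_of_set A) (\<lambda>x. x) = log 2 (card A)"
proof -
  have "ent (pmf_of_set A) (\<lambda>x. x) = pmf_E (pmf_of_set A) (\<lambda>_. log 2 (card A))"
    unfolding ent_def using assms
    by (intro pmf_E_cong) (simp add: pmf_of_set map_pmf_ident log_divide card_gt_0_iff)
  then show ?thesis by simp
qed

lemma cent_pair_pmf:
  assumes "finite (set_pmf p)" "finite (set_pmf q)"
  shows "cent (pair_pmf p q) (\<lambda>w. Y (snd w)) fst = ent q Y"
proof -
  have "pair_pmf p q = bind_pmf p (\<lambda>c. map_pmf (Pair c) q)"
    by (simp add: pair_pmf_def map_pmf_def)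
  then show ?thesis using assms by (simp add: cent_mix)
qed

lemma ent_pair_pmf:
  assumes "finite (set_pmf p)" "finite (set_pmf q)"
  shows "ent (pair_pmf p q) (\<lambda>w. (X (fst w), Y (snd w))) = ent p X + ent q Y"
proof -
  have "ent (pair_pmf p q) (\<lambda>w. (X (fst w), Y (snd w))) =
      ent (pair_pmf (map_pmf X p) (map_pmf Y q)) (\<lambda>w. w)"
    by (simp add: map_pair[symmetric] ent_map case_prod_unfold)
  also have "\<dots> = ent (pair_pmf (map_pmf X p) (map_pmf Y q)) (\<lambda>w. (snd w, fst w))"
    by (rule ent_eqI) (auto simp: prod_eq_iff)
  also have "\<dots> = ent (pair_pmf (map_pmf X p) (map_pmf Y q)) fst + ent (map_pmf Y q) (\<lambda>y. y)"
    using assms cent_pair_pmf[of "map_pmf X p" "map_pmf Y q" "\<lambda>y. y"] by (simp add: cent_def)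
  also have "ent (pair_pmf (map_pmf X p) (map_pmf Y q)) fst = ent (map_pmf fst (pair_pmf (map_pmf X p) (map_pmf Y q))) (\<lambda>x. x)"
    by (simp add: ent_map)
  finally show ?thesis by (simp add: map_fst_pair_pmf ent_map)
qed

text \<open>The guess \<open>g\<close> induces the conditional law that gives weight 1/2 to the guessed value and
  spreads 1/2 evenly over all values.\<close>

lemma fano:
  fixes X :: "'w \<Rightarrow> 'a" and Y :: "'w \<Rightarrow> 'b"
  assumes fin: "finite (set_pmf p)" and A: "finite A" "X ` set_pmf p \<subseteq> A"
  shows "cent p X Y \<le> 1 + measure_pmf.prob p {w. g (Y w) \<noteq> X w} * log 2 (card A)"
proof -
  let ?S = "set_pmf p"
  have ne: "A \<noteq> {}" using A set_pmf_not_empty[of p] by auto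
  then have cA: "1 \<le> real (card A)" using A card_gt_0_iff[of A] by (simp add: Suc_leI)
  define q where "q x y = (if x = g y then 1 / 2 else 1 / (2 * real (card A)))" for x y
  have q: "q x y \<le> (if x = g y then 1 / 2 else 0) + 1 / (2 * real (card A))" for x y
    by (simp add: q_def)
  have "cent p X Y \<le> pmf_E p (\<lambda>w. - log 2 (q (X w) (Y w)))"
  proof (rule cent_le_cross_entropy[OF fin])
    fix w
    have "(\<Sum>x\<in>X ` ?S. q x (Y w)) \<le> (\<Sum>x\<in>A. q x (Y w))"
      using A by (intro sum_mono2) (auto simp: q_def)
    also have "\<dots> \<le> (\<Sum>x\<in>A. (if x = g (Y w) then 1 / 2 else 0) + 1 / (2 * real (card A)))"
      by (intro sum_mono q)
    also have "\<dots> \<le> 1" using A cA by (simp add: sum.distrib sum.delta)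
    finally show "(\<Sum>x\<in>X ` ?S. q x (Y w)) \<le> 1" .
  qed (use cA in \<open>auto simp: q_def\<close>)
  \<comment> \<open>A correct guess costs one bit, a wrong one costs 1 + log |A| bits.\<close>
  also have "\<dots> = pmf_E p (\<lambda>w. 1 + log 2 (card A) * indicator {w. g (Y w) \<noteq> X w} w)"
    using cA by (intro pmf_E_cong) (auto simp: q_def indicator_def log_divide log_mult)
  also have "\<dots> = 1 + log 2 (card A) * measure_pmf.prob p {w. g (Y w) \<noteq> X w}"
    using fin by (subst pmf_E_add) auto
  finally show ?thesis by (simp add: mult.commute)
qed

subsection \<open>Channels\<close>

text \<open>Disintegration over the values of \<open>C\<close>: each point lies in one fibre, whose
  probability cancels the normalisation of the conditional law.\<close>

lemma bind_cond_pmf_fibres: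
  "bind_pmf (map_pmf C p) (\<lambda>c. cond_pmf p {w. C w = c}) = p"
proof (rule pmf_eqI)
  fix w
  let ?P = "measure_pmf.prob p {w'. C w' = C w}"
  have "pmf (bind_pmf (map_pmf C p) (\<lambda>c. cond_pmf p {w. C w = c})) w =
      pmf_E p (\<lambda>w'. pmf (cond_pmf p {v. C v = C w'}) w)"
    by (simp add: pmf_bind)
  also have "\<dots> = pmf_E p (\<lambda>w'. indicator {w'. C w' = C w} w' * (pmf p w / ?P))"
  proof (rule pmf_E_cong)
    fix w' assume "w' \<in> set_pmf p"
    then have "set_pmf p \<inter> {v. C v = C w'} \<noteq> {}" by auto
    then show "pmf (cond_pmf p {v. C v = C w'}) w = indicator {w'. C w' = C w} w' * (pmf p w / ?P)"
      by (auto simp: pmf_cond indicator_def)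
  qed
  also have "\<dots> = ?P * (pmf p w / ?P)" by simp
  also have "\<dots> = pmf p w"
  proof (cases "w \<in> set_pmf p")
    case True
    then have "0 < ?P" by (intro measure_pmf_posI) auto
    then show ?thesis by simp
  qed (simp add: set_pmf_iff)
  finally show "pmf (bind_pmf (map_pmf C p) (\<lambda>c. cond_pmf p {w. C w = c})) w = pmf p w" .
qed

definition joint :: "('x \<Rightarrow> 'z pmf) \<Rightarrow> 'x pmf \<Rightarrow> ('x \<times> 'z) pmf" where
  "joint W p = bind_pmf p (\<lambda>x. map_pmf (Pair x) (W x))"

lemma map_fst_joint [simp]: "map_pmf fst (joint W p) = p"
  by (simp add: joint_def map_bind_pmf map_pmf_comp bind_return_pmf')

lemma map_joint: "map_pmf (\<lambda>w. (x (fst w), snd w)) (joint (\<lambda>w. W (x w)) p) = joint W (map_pmf x p)"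
  by (simp add: joint_def map_bind_pmf map_pmf_comp bind_map_pmf)

lemma finite_joint [simp]:
  fixes W :: "'x \<Rightarrow> 'z::finite pmf"
  assumes "finite (set_pmf p)"
  shows "finite (set_pmf (joint W p))"
  using assms by (simp add: joint_def)

text \<open>This is I(X; g(Z) | a(X)) for input X and output Z; since X determines a(X), the second
  term conditions on X alone. A constant \<open>a\<close> gives I(X; g(Z)), and \<open>snd\<close>
  gives I(X1; g(Z) | X2).\<close>

definition rate :: "('x \<Rightarrow> 'z pmf) \<Rightarrow> ('x \<Rightarrow> 'a) \<Rightarrow> ('z \<Rightarrow> 'b) \<Rightarrow> 'x pmf \<Rightarrow> real" where
  "rate W a g p = cent (joint W p) (\<lambda>w. g (snd w)) (\<lambda>w. a (fst w)) -
                  cent (joint W p) (\<lambda>w. g (snd w)) fst"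

lemma cent_joint_input:
  fixes W :: "'x \<Rightarrow> 'z::finite pmf"
  assumes "finite (set_pmf p)"
  shows "cent (joint W p) (\<lambda>w. g (snd w)) fst = pmf_E p (\<lambda>x. ent (W x) g)"
  using assms by (simp add: joint_def cent_mix)

text \<open>The Markov property of one channel use. In information content \<open>f\<close> lies
  between the input and the full state, and at both extremes the output entropy is the same.\<close>

lemma cent_joint_markov:
  fixes W :: "'x \<Rightarrow> 'z::finite pmf"
  assumes fin: "finite (set_pmf p)"
    and f: "\<And>w w'. w \<in> set_pmf p \<Longrightarrow> w' \<in> set_pmf p \<Longrightarrow> f w = f w' \<Longrightarrow> x w = x w'"
  shows "cent (joint (\<lambda>w. W (x w)) p) (\<lambda>w. g (snd w)) (\<lambda>w. f (fst w)) =
         cent (joint W (map_pmf x p)) (\<lambda>w. g (snd w)) fst"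
proof (rule antisym)
  let ?S = "joint (\<lambda>w. W (x w)) p"
  have S: "finite (set_pmf ?S)" using fin by simp
  have mem: "fst w \<in> set_pmf p" if "w \<in> set_pmf ?S" for w
    using imageI[OF that, of fst] by (simp flip: set_map_pmf)
  have "cent ?S (\<lambda>w. g (snd w)) (\<lambda>w. f (fst w)) \<le> cent ?S (\<lambda>w. g (snd w)) (\<lambda>w. x (fst w))"
    by (rule cent_mono[OF S]) (use f mem in auto)
  also have "\<dots> = cent (joint W (map_pmf x p)) (\<lambda>w. g (snd w)) fst"
    by (simp flip: map_joint add: cent_map)
  finally show "cent ?S (\<lambda>w. g (snd w)) (\<lambda>w. f (fst w)) \<le> \<dots>" .
  have "cent (joint W (map_pmf x p)) (\<lambda>w. g (snd w)) fst = cent ?S (\<lambda>w. g (snd w)) fst"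
    using fin by (simp add: cent_joint_input)
  also have "\<dots> \<le> cent ?S (\<lambda>w. g (snd w)) (\<lambda>w. f (fst w))"
    by (rule cent_mono[OF S]) auto
  finally show "cent (joint W (map_pmf x p)) (\<lambda>w. g (snd w)) fst \<le> \<dots>" .
qed

lemma cent_disintegrate:
  assumes m: "finite (set_pmf m)" and p: "\<And>c. c \<in> set_pmf m \<Longrightarrow> finite (set_pmf (p c))"
  shows "cent (bind_pmf m (\<lambda>c. map_pmf (Pair c) (p c))) (\<lambda>w. X (snd w)) (\<lambda>w. (Y (snd w), fst w)) =
         pmf_E m (\<lambda>c. cent (p c) X Y)"
proof -
  let ?M = "bind_pmf m (\<lambda>c. map_pmf (Pair c) (p c))"
  have "cent ?M (\<lambda>w. X (snd w)) (\<lambda>w. (Y (snd w), fst w)) =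
      ent ?M (\<lambda>w. ((X (snd w), Y (snd w)), fst w)) - ent ?M (\<lambda>w. (Y (snd w), fst w))"
    unfolding cent_def by (intro arg_cong2[where f="(-)"] ent_eqI) auto
  also have "\<dots> = cent ?M (\<lambda>w. (X (snd w), Y (snd w))) fst - cent ?M (\<lambda>w. Y (snd w)) fst"
    by (simp add: cent_def)
  also have "\<dots> = pmf_E m (\<lambda>c. ent (p c) (\<lambda>w. (X w, Y w)) - ent (p c) Y)"
    using m p by (simp add: cent_mix pmf_E_diff)
  finally show ?thesis by (simp add: cent_def)
qed

text \<open>H(g(Z) | X) is linear in the input law, so its average depends only on the averaged law.
  Only the first term still sees the label.\<close>

lemma rate_mix:
  fixes W :: "'x \<Rightarrow> 'z::finite pmf"
  assumes m: "finite (set_pmf m)" and k: "\<And>c. c \<in> set_pmf m \<Longrightarrow> finite (set_pmf (k c))"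
  defines "M \<equiv> bind_pmf m (\<lambda>c. map_pmf (Pair c) (joint W (k c)))"
  shows "pmf_E m (\<lambda>c. rate W a g (k c)) =
     cent M (\<lambda>w. g (snd (snd w))) (\<lambda>w. (a (fst (snd w)), fst w)) -
     cent (joint W (bind_pmf m k)) (\<lambda>w. g (snd w)) fst"
proof -
  have "pmf_E m (\<lambda>c. cent (joint W (k c)) (\<lambda>w. g (snd w)) fst) =
      pmf_E m (\<lambda>c. pmf_E (k c) (\<lambda>x. ent (W x) g))"
    using k by (intro pmf_E_cong) (simp add: cent_joint_input)
  also have "\<dots> = pmf_E (bind_pmf m k) (\<lambda>x. ent (W x) g)"
    using m k by (simp add: pmf_E_bind)
  also have "\<dots> = cent (joint W (bind_pmf m k)) (\<lambda>w. g (snd w)) fst"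
    using m k by (simp add: cent_joint_input)
  finally have 1: "pmf_E m (\<lambda>c. cent (joint W (k c)) (\<lambda>w. g (snd w)) fst) = \<dots>" .
  have "pmf_E m (\<lambda>c. cent (joint W (k c)) (\<lambda>w. g (snd w)) (\<lambda>w. a (fst w))) =
     cent M (\<lambda>w. g (snd (snd w))) (\<lambda>w. (a (fst (snd w)), fst w))"
    unfolding M_def by (rule cent_disintegrate[symmetric]) (use m k in auto)
  with 1 show ?thesis using m by (simp add: rate_def pmf_E_diff)
qed

lemma map_snd_mix_joint:
  "map_pmf snd (bind_pmf m (\<lambda>c. map_pmf (Pair c) (joint W (k c)))) = joint W (bind_pmf m k)"
  by (simp add: map_bind_pmf map_pmf_comp joint_def bind_assoc_pmf)

text \<open>Forgetting the label can only raise the first entropy in \<open>rate_mix\<close>, and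
  the linear term is unaffected.\<close>

lemma rate_concave:
  fixes W :: "'x \<Rightarrow> 'z::finite pmf"
  assumes m: "finite (set_pmf m)" and k: "\<And>c. c \<in> set_pmf m \<Longrightarrow> finite (set_pmf (k c))"
  shows "pmf_E m (\<lambda>c. rate W a g (k c)) \<le> rate W a g (bind_pmf m k)"
proof -
  let ?M = "bind_pmf m (\<lambda>c. map_pmf (Pair c) (joint W (k c)))"
  have "cent ?M (\<lambda>w. g (snd (snd w))) (\<lambda>w. (a (fst (snd w)), fst w)) \<le>
      cent ?M (\<lambda>w. g (snd (snd w))) (\<lambda>w. a (fst (snd w)))"
    by (rule cent_mono) (use m k in auto)
  also have "\<dots> = cent (joint W (bind_pmf m k)) (\<lambda>w. g (snd w)) (\<lambda>w. a (fst w))"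
    by (simp flip: map_snd_mix_joint add: cent_map)
  finally show ?thesis
    by (subst rate_mix[OF m k]) (auto simp: rate_def)
qed

text \<open>\<open>k\<close> is the conditional input law given \<open>C\<close>. Averaging the
  rates of these laws amounts to adding \<open>C\<close> to the conditioning of the output.\<close>

lemma joint_disintegrate:
  fixes W :: "'x \<Rightarrow> 'z::finite pmf" and p :: "'w pmf" and C :: "'w \<Rightarrow> 'c" and x :: "'w \<Rightarrow> 'x"
  assumes fin: "finite (set_pmf p)"
  defines "k \<equiv> \<lambda>c. map_pmf x (cond_pmf p {w. C w = c})"
  shows "bind_pmf (map_pmf C p) k = map_pmf x p"
    and "pmf_E (map_pmf C p) (\<lambda>c. rate W a g (k c)) =
         cent (joint (\<lambda>w. W (x w)) p) (\<lambda>w. g (snd w)) (\<lambda>w. (a (x (fst w)), C (fst w))) -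
         cent (joint W (map_pmf x p)) (\<lambda>w. g (snd w)) fst"
proof -
  let ?cond = "\<lambda>c. cond_pmf p {w. C w = c}"
  show b: "bind_pmf (map_pmf C p) k = map_pmf x p"
    by (simp add: k_def map_bind_pmf[symmetric] bind_cond_pmf_fibres)
  have set: "set_pmf (?cond c) = set_pmf p \<inter> {w. C w = c}" if "c \<in> set_pmf (map_pmf C p)" for c
    using that by (intro set_cond_pmf) auto
  have fk: "finite (set_pmf (k c))" if "c \<in> set_pmf (map_pmf C p)" for c
    using set[OF that] fin by (simp add: k_def)
  let ?M = "bind_pmf (map_pmf C p) (\<lambda>c. map_pmf (Pair c) (joint W (k c)))"
  have "?M = bind_pmf (map_pmf C p) (\<lambda>c. bind_pmf (?cond c) (\<lambda>w. map_pmf (\<lambda>z. (c, x w, z)) (W (x w))))"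
    by (simp add: joint_def k_def map_bind_pmf bind_map_pmf map_pmf_comp)
  \<comment> \<open>Under the conditional law \<open>C w = c\<close>, so the label can be recomputed
    from \<open>w\<close> and the fibres reassembled.\<close>
  also have "\<dots> = bind_pmf (map_pmf C p) (\<lambda>c. bind_pmf (?cond c) (\<lambda>w. map_pmf (\<lambda>z. (C w, x w, z)) (W (x w))))"
    by (intro bind_pmf_cong refl) (auto simp: set)
  also have "\<dots> = bind_pmf p (\<lambda>w. map_pmf (\<lambda>z. (C w, x w, z)) (W (x w)))"
    by (simp only: bind_assoc_pmf[symmetric] bind_cond_pmf_fibres)
  also have "\<dots> = map_pmf (\<lambda>w. (C (fst w), x (fst w), snd w)) (joint (\<lambda>w. W (x w)) p)"
    by (simp add: joint_def map_bind_pmf map_pmf_comp)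
  finally have M: "?M = \<dots>" .
  have "pmf_E (map_pmf C p) (\<lambda>c. rate W a g (k c)) =
     cent ?M (\<lambda>w. g (snd (snd w))) (\<lambda>w. (a (fst (snd w)), fst w)) -
     cent (joint W (bind_pmf (map_pmf C p) k)) (\<lambda>w. g (snd w)) fst"
    by (rule rate_mix) (use fin fk in auto)
  then show "pmf_E (map_pmf C p) (\<lambda>c. rate W a g (k c)) =
         cent (joint (\<lambda>w. W (x w)) p) (\<lambda>w. g (snd w)) (\<lambda>w. (a (x (fst w)), C (fst w))) -
         cent (joint W (map_pmf x p)) (\<lambda>w. g (snd w)) fst"
    unfolding M b by (simp add: cent_map)
qed

subsection \<open>Compactness of the averaged bounds\<close>

definition pvec :: "'x::finite pmf \<Rightarrow> real ^ 'x" where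
  "pvec p = (\<chi> x. pmf p x)"

text \<open>Entropy as a function of the input vector: the inner sums are the probabilities of the
  values of \<open>f\<close>, linear in \<open>v\<close>. This form makes continuity
  accessible.\<close>

definition entV :: "('x::finite \<Rightarrow> 'z::finite pmf) \<Rightarrow> ('x \<times> 'z \<Rightarrow> 'u::finite) \<Rightarrow> real ^ 'x \<Rightarrow> real" where
  "entV W f v = (\<Sum>u\<in>UNIV. - ((\<Sum>x\<in>UNIV. v $ x * pmf (map_pmf (\<lambda>z. f (x, z)) (W x)) u) *
                    log 2 (\<Sum>x\<in>UNIV. v $ x * pmf (map_pmf (\<lambda>z. f (x, z)) (W x)) u)))"

lemma ent_joint_eq_entV: "ent (joint W p) f = entV W f (pvec p)"
proof -
  have eq: "pmf (map_pmf f (joint W p)) u = (\<Sum>x\<in>UNIV. pvec p $ x * pmf (map_pmf (\<lambda>z. f (x, z)) (W x)) u)" for u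
    by (simp add: joint_def map_bind_pmf map_pmf_comp pmf_bind pvec_def
        integral_measure_pmf[of UNIV])
  have "ent (joint W p) f = ent (map_pmf f (joint W p)) (\<lambda>u. u)"
    by (simp add: ent_map)
  also have "\<dots> = (\<Sum>u\<in>set_pmf (map_pmf f (joint W p)). - (pmf (map_pmf f (joint W p)) u * log 2 (pmf (map_pmf f (joint W p)) u)))"
    unfolding ent_def by (subst pmf_E_finite) (simp_all add: map_pmf_ident)
  \<comment> \<open>Values outside the support contribute 0 times a logarithm, hence 0.\<close>
  also have "\<dots> = (\<Sum>u\<in>UNIV. - (pmf (map_pmf f (joint W p)) u * log 2 (pmf (map_pmf f (joint W p)) u)))"
    by (rule sum.mono_neutral_left) (auto simp: set_pmf_iff simp del: set_map_pmf)
  also have "\<dots> = entV W f (pvec p)"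
    by (simp add: entV_def eq)
  finally show ?thesis .
qed

definition rateV ::
  "('x::finite \<Rightarrow> 'z::finite pmf) \<Rightarrow> ('x \<Rightarrow> 'a::finite) \<Rightarrow> ('z \<Rightarrow> 'b::finite) \<Rightarrow> real ^ 'x \<Rightarrow> real" where
  "rateV W a g v = (entV W (\<lambda>w. (g (snd w), a (fst w))) v - entV W (\<lambda>w. a (fst w)) v) -
                   (entV W (\<lambda>w. (g (snd w), fst w)) v - entV W fst v)"

lemma rate_eq_rateV: "rate W a g p = rateV W a g (pvec p)"
  by (simp add: rate_def cent_def rateV_def ent_joint_eq_entV)

definition prob_simplex :: "(real ^ 'x::finite) set" where
  "prob_simplex = {v. (\<forall>x. 0 \<le> v $ x) \<and> (\<Sum>x\<in>UNIV. v $ x) = 1}"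

lemma range_pvec: "range pvec = (prob_simplex :: (real ^ 'x::finite) set)"
proof (intro equalityI subsetI)
  fix v :: "real ^ 'x" assume "v \<in> range pvec"
  then show "v \<in> prob_simplex"
    by (auto simp: prob_simplex_def pvec_def intro!: sum_pmf_eq_1)
next
  fix v :: "real ^ 'x" assume v: "v \<in> prob_simplex"
  then have "(\<integral>\<^sup>+x. ennreal (v $ x) \<partial>count_space UNIV) = 1"
    by (simp add: prob_simplex_def nn_integral_count_space_finite)
  then have "pvec (embed_pmf (\<lambda>x. v $ x)) = v"
    using v by (simp add: pvec_def pmf_embed_pmf prob_simplex_def vec_eq_iff)
  then show "v \<in> range pvec" by (metis rangeI)
qed

lemma compact_prob_simplex: "compact (prob_simplex :: (real ^ 'x::finite) set)"
unfolding compact_eq_bounded_closed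
proof (intro conjI)
  have "prob_simplex = (\<Inter>x::'x. {v. 0 \<le> v $ x}) \<inter> {v. (\<Sum>x\<in>UNIV. v $ x) = 1}"
    by (auto simp: prob_simplex_def)
  also have "closed \<dots>"
    by (intro closed_Int closed_INT ballI closed_Collect_le closed_Collect_eq continuous_intros)
  finally show "closed (prob_simplex :: (real ^ 'x) set)" .
  show "bounded (prob_simplex :: (real ^ 'x) set)"
  proof (rule boundedI)
    fix v :: "real ^ 'x" assume "v \<in> prob_simplex"
    then show "norm v \<le> 1"
      using norm_le_l1_cart[of v] by (simp add: prob_simplex_def)
  qed
qed

lemma convex_prob_simplex: "convex (prob_simplex :: (real ^ 'x::finite) set)"
  by (rule convexI) (auto simp: prob_simplex_def sum.distrib sum_distrib_left[symmetric])

section \<open>Continuity of entropy up to the boundary of the simplex\<close>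

lemma tendsto_xlogx: "((\<lambda>t::real. t * log 2 t) \<longlongrightarrow> 0) (at 0 within {0..})"
proof -
  have "{0..} - {0} = {0::real<..} - {0}" by auto
  then have "at (0::real) within {0..} = at_right 0"
    by (simp only: at_within_def)
  moreover have "((\<lambda>t::real. t * log 2 t) \<longlongrightarrow> 0) (at_right 0)"
    by real_asymp
  ultimately show ?thesis by (simp only:)
qed

lemma isCont_xlogx_within: "t > 0 \<Longrightarrow> continuous (at t within {0..}) (\<lambda>t. t * log 2 t)"
  unfolding log_def
  by (rule continuous_at_imp_continuous_at_within, intro continuous_intros) auto

text \<open>At 0 the product evaluates to 0, which agrees with the one-sided limit, so vanishing
  probabilities do no harm.\<close>

lemma continuous_on_xlogx: "continuous_on {0..} (\<lambda>t::real. t * log 2 t)"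
  unfolding continuous_on_eq_continuous_within
proof (intro ballI)
  fix t :: real assume "t \<in> {0..}"
  then have "t = 0 \<or> t > 0" by auto
  then show "continuous (at t within {0..}) (\<lambda>t. t * log 2 t)"
    using isCont_xlogx_within tendsto_xlogx by (auto simp: continuous_within)
qed

lemma continuous_on_entV: "continuous_on prob_simplex (entV W f)"
  unfolding entV_def
  by (intro continuous_on_sum continuous_on_minus
      continuous_on_compose2[OF continuous_on_xlogx] continuous_intros)
     (auto simp: prob_simplex_def intro!: sum_nonneg)

lemma continuous_on_rateV: "continuous_on prob_simplex (rateV W a g)"
  unfolding rateV_def by (intro continuous_on_diff continuous_on_entV)

text \<open>With F for the feedback this is H(F|X1) + H(F|X2) - H(F|X1,X2) - H(F), which equals
  I(X1;X2|F) - I(X1;X2). Its average over the label is the slack of the dependence balance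
  bound.\<close>

definition balance :: "('a \<times> 'b \<Rightarrow> 'z pmf) \<Rightarrow> ('z \<Rightarrow> 'f) \<Rightarrow> ('a \<times> 'b) pmf \<Rightarrow> real" where
  "balance W f p = rate W fst f p + rate W snd f p - rate W (\<lambda>_. ()) f p"

text \<open>The bounds that are not part of the profile are concave in the input law and can be evaluated
  at its average, the first coordinate.\<close>

definition profile ::
  "('a::finite \<times> 'b::finite \<Rightarrow> 'z::finite pmf) \<Rightarrow> ('z \<Rightarrow> 'f::finite) \<Rightarrow> ('a \<times> 'b) pmf
    \<Rightarrow> (real ^ ('a \<times> 'b)) \<times> real \<times> real" where
  "profile W f p = (pvec p, rate W (\<lambda>_. ()) (\<lambda>z. z) p, balance W f p)"

lemma compact_range_profile: "compact (range (profile W f))"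
proof -
  let ?F = "\<lambda>v. (v, rateV W (\<lambda>_. ()) (\<lambda>z. z) v,
      rateV W fst f v + rateV W snd f v - rateV W (\<lambda>_. ()) f v)"
  have "range (profile W f) = ?F ` range pvec"
    by (simp add: profile_def balance_def rate_eq_rateV image_image)
  then show ?thesis unfolding range_pvec
    by (auto intro!: compact_continuous_image compact_prob_simplex continuous_on_Pair
        continuous_on_add continuous_on_diff continuous_on_rateV continuous_on_id)
qed

lemma hull_profile_simplex:
  assumes "v \<in> convex hull range (profile W f)"
  shows "fst v \<in> prob_simplex"
proof -
  have "convex hull range (profile W f) \<subseteq> prob_simplex \<times> UNIV"
    by (rule hull_minimal)
       (use range_pvec in \<open>auto simp: profile_def intro!: convex_Times convex_prob_simplex\<close>)
  then show ?thesis using assms by auto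
qed

lemma mix_in_hull:
  assumes "finite (set_pmf m)"
  shows "(pvec (bind_pmf m k), pmf_E m (\<lambda>c. rate W (\<lambda>_. ()) (\<lambda>z. z) (k c)), pmf_E m (\<lambda>c. balance W f (k c)))
     \<in> convex hull range (profile W f)"
proof -
  have "(\<Sum>c\<in>set_pmf m. pmf m c *\<^sub>R profile W f (k c)) \<in> convex hull range (profile W f)"
    using assms by (intro convex_sum) (auto simp: hull_inc intro: sum_pmf_eq_1)
  also have "(\<Sum>c\<in>set_pmf m. pmf m c *\<^sub>R profile W f (k c)) =
     (pvec (bind_pmf m k), pmf_E m (\<lambda>c. rate W (\<lambda>_. ()) (\<lambda>z. z) (k c)), pmf_E m (\<lambda>c. balance W f (k c)))"
    using assms
    by (auto simp: prod_eq_iff fst_sum snd_sum profile_def pmf_E_finite pvec_def pmf_bind vec_eq_iff)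
  finally show ?thesis .
qed

text \<open>Points of the hull are indexed convex combinations, so the labels of the mixture can be
  natural numbers. This later permits addition modulo \<open>N\<close>.\<close>

lemma hull_is_mix:
  assumes "v \<in> convex hull range (profile W f)"
  obtains m :: "nat pmf" and k where "finite (set_pmf m)"
    "v = (pvec (bind_pmf m k), pmf_E m (\<lambda>c. rate W (\<lambda>_. ()) (\<lambda>z. z) (k c)), pmf_E m (\<lambda>c. balance W f (k c)))"
proof -
  from assms obtain n u x where u: "\<And>i. i \<in> {1..n} \<Longrightarrow> 0 \<le> u i" "sum u {1..n} = 1"
    and x: "\<And>i. i \<in> {1..n} \<Longrightarrow> x i \<in> range (profile W f)"
    and v: "(\<Sum>i\<in>{1..n::nat}. u i *\<^sub>R x i) = v"
    unfolding convex_hull_indexed by blast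
  define k where "k i = (SOME p. x i = profile W f p)" for i
  have k: "x i = profile W f (k i)" if "i \<in> {1..n}" for i
    unfolding k_def by (rule someI_ex) (use x[OF that] in auto)
  let ?u = "\<lambda>i. if i \<in> {1..n} then u i else 0"
  define m where "m = embed_pmf ?u"
  have "(\<integral>\<^sup>+i. ennreal (?u i) \<partial>count_space UNIV) = (\<integral>\<^sup>+i. ennreal (u i) \<partial>count_space {1..n})"
    by (subst nn_integral_count_space_indicator) (auto intro!: nn_integral_cong simp: indicator_def)
  also have "\<dots> = 1"
    using u by (simp add: nn_integral_count_space_finite del: atLeastAtMost_iff)
  finally have pm: "pmf m i = ?u i" for i
    unfolding m_def by (subst pmf_embed_pmf) (use u in auto)
  have set: "set_pmf m \<subseteq> {1..n}" by (auto simp: set_pmf_iff pm split: if_splits)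
  then have fin: "finite (set_pmf m)" by (rule finite_subset) simp
  have sum: "(\<Sum>c\<in>set_pmf m. pmf m c *\<^sub>R h c) = (\<Sum>i\<in>{1..n}. u i *\<^sub>R h i)" for h :: "nat \<Rightarrow> (real ^ ('a \<times> 'b)) \<times> real \<times> real"
    by (rule sum.mono_neutral_cong_left) (use set in \<open>auto simp: set_pmf_iff pm\<close>)
  have "v = (\<Sum>c\<in>set_pmf m. pmf m c *\<^sub>R profile W f (k c))"
    unfolding sum v[symmetric] using k by (intro sum.cong) auto
  also have "\<dots> = (pvec (bind_pmf m k), pmf_E m (\<lambda>c. rate W (\<lambda>_. ()) (\<lambda>z. z) (k c)), pmf_E m (\<lambda>c. balance W f (k c)))"
    using fin
    by (auto simp: prod_eq_iff fst_sum snd_sum profile_def pmf_E_finite pvec_def pmf_bind vec_eq_iff)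
  finally show ?thesis using fin that by blast
qed

text \<open>Witnesses for the tolerances 1/(n+1) have a subsequence converging in \<open>K\<close>,
  and continuity carries all the bounds to that one limit.\<close>

lemma compact_approx_exact:
  fixes K :: "'a::metric_space set" and F :: "('a \<Rightarrow> real) set"
  assumes K: "compact K" and F: "\<forall>f\<in>F. continuous_on K f"
    and approx: "\<And>\<delta>. 0 < \<delta> \<Longrightarrow> \<exists>v\<in>K. \<forall>f\<in>F. - \<delta> \<le> f v"
  shows "\<exists>v\<in>K. \<forall>f\<in>F. 0 \<le> f v"
proof -
  have "\<exists>v\<in>K. \<forall>f\<in>F. - inverse (real (Suc n)) \<le> f v" for n
    by (rule approx) simp
  then obtain v where v: "\<And>n. v n \<in> K" "\<And>n f. f \<in> F \<Longrightarrow> - inverse (real (Suc n)) \<le> f (v n)"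
    by metis
  obtain l r where l: "l \<in> K" "strict_mono (r :: nat \<Rightarrow> nat)" "(v \<circ> r) \<longlonglongrightarrow> l"
    using K v(1) unfolding compact_def by metis
  have "0 \<le> f l" if f: "f \<in> F" for f
  proof (rule LIMSEQ_le)
    show "(\<lambda>n. f ((v \<circ> r) n)) \<longlonglongrightarrow> f l"
      using v(1) by (intro continuous_on_tendsto_compose[OF bspec[OF F f] l(3) l(1)]) simp
    show "(\<lambda>n. - inverse (real (Suc (r n)))) \<longlonglongrightarrow> 0"
      using tendsto_minus[OF LIMSEQ_subseq_LIMSEQ[OF LIMSEQ_inverse_real_of_nat l(2)]]
      by (simp add: o_def)
  qed (use v(2)[OF f] in auto)
  with l show ?thesis by auto
qed

subsection \<open>Converse for a fixed code\<close>

definition chan :: "('x1, 'x2, 'y1, 'y2, 'f1, 'f2) icgf \<Rightarrow> 'x1 \<times> 'x2 \<Rightarrow> ('y1 \<times> 'y2 \<times> 'f1 \<times> 'f2) pmf" where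
  "chan ch x = ch (fst x) (snd x)"

text \<open>The state after \<open>m\<close> uses fixes the inputs of use \<open>m + 1\<close>;
  encoders count time from 1, hence \<open>Suc m\<close>.\<close>

definition inputs ::
  "('x1, 'x2, 'y1, 'y2, 'f1, 'f2) ic_code \<Rightarrow> nat \<Rightarrow> (nat \<times> nat) \<times> ('y1 \<times> 'y2 \<times> 'f1 \<times> 'f2) list \<Rightarrow> 'x1 \<times> 'x2" where
  "inputs c m w = (enc1 c (Suc m) (fst (fst w)) (map fb1 (snd w)),
                   enc2 c (Suc m) (snd (fst w)) (map fb2 (snd w)))"

definition fbs :: "'y1 \<times> 'y2 \<times> 'f1 \<times> 'f2 \<Rightarrow> 'f1 \<times> 'f2" where
  "fbs z = (fb1 z, fb2 z)"

definition outs :: "'y1 \<times> 'y2 \<times> 'f1 \<times> 'f2 \<Rightarrow> 'y1 \<times> 'y2" where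
  "outs z = (out1 z, out2 z)"

definition outs_fb1 :: "'y1 \<times> 'y2 \<times> 'f1 \<times> 'f2 \<Rightarrow> 'y1 \<times> 'y2 \<times> 'f1" where
  "outs_fb1 z = (out1 z, out2 z, fb1 z)"

definition outs_fb2 :: "'y1 \<times> 'y2 \<times> 'f1 \<times> 'f2 \<Rightarrow> 'y1 \<times> 'y2 \<times> 'f2" where
  "outs_fb2 z = (out1 z, out2 z, fb2 z)"

lemma map_eq_if_determined:
  assumes "map g xs = map g ys" and "\<And>z z'. g z = g z' \<Longrightarrow> f z = f z'"
  shows "map f xs = map f ys"
proof (rule nth_equalityI)
  show len: "length (map f xs) = length (map f ys)"
    using map_eq_imp_length_eq[OF assms(1)] by simp
  fix i assume "i < length (map f xs)"
  then have i: "i < length xs" "i < length ys" using len by simp_all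
  then have "g (xs ! i) = g (ys ! i)"
    using arg_cong[OF assms(1), of "\<lambda>l. l ! i"] by simp
  then have "f (xs ! i) = f (ys ! i)" by (rule assms(2))
  then show "map f xs ! i = map f ys ! i" using i by simp
qed

lemma map_fb_eq:
  fixes h h' :: "('y1 \<times> 'y2 \<times> 'f1 \<times> 'f2) list"
  assumes "map fbs h = map fbs h'"
  shows "map fb1 h = map fb1 h'" "map fb2 h = map fb2 h'"
  using map_eq_if_determined[OF assms, of fb1] map_eq_if_determined[OF assms, of fb2] by (simp_all add: fbs_def)

definition err1 ::
  "('x1, 'x2, 'y1, 'y2, 'f1, 'f2) icgf \<Rightarrow> ('x1, 'x2, 'y1, 'y2, 'f1, 'f2) ic_code \<Rightarrow> nat \<Rightarrow> nat \<Rightarrow> nat \<Rightarrow> real" where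
  "err1 ch c M1 M2 n = measure_pmf.prob (code_pmf ch c n M1 M2) {((w1, w2), h). dec1 c (map out1 h) \<noteq> w1}"

definition err2 ::
  "('x1, 'x2, 'y1, 'y2, 'f1, 'f2) icgf \<Rightarrow> ('x1, 'x2, 'y1, 'y2, 'f1, 'f2) ic_code \<Rightarrow> nat \<Rightarrow> nat \<Rightarrow> nat \<Rightarrow> real" where
  "err2 ch c M1 M2 n = measure_pmf.prob (code_pmf ch c n M1 M2) {((w1, w2), h). dec2 c (map out2 h) \<noteq> w2}"

context
  fixes ch :: "('x1::finite, 'x2::finite, 'y1::finite, 'y2::finite, 'f1::finite, 'f2::finite) icgf"
    and c :: "('x1, 'x2, 'y1, 'y2, 'f1, 'f2) ic_code" and M1 M2 :: nat
  assumes M1: "1 \<le> M1" and M2: "1 \<le> M2"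
begin

abbreviation "law m \<equiv> code_pmf ch c m M1 M2"
abbreviation "step m \<equiv> joint (\<lambda>w. chan ch (inputs c m w)) (law m)"
abbreviation "input_law m \<equiv> map_pmf (inputs c m) (law m)"
abbreviation "msgs \<equiv> pair_pmf (pmf_of_set {1..M1}) (pmf_of_set {1..M2})"

text \<open>\<open>V\<close> selects a part of the message pair and \<open>g\<close> the observed
  part of the outputs. Taking \<open>V\<close> constant, the identity, \<open>fst\<close> or
  \<open>snd\<close> lets one telescoping argument serve every bound.\<close>

definition seq_ent :: "nat \<Rightarrow> ('y1 \<times> 'y2 \<times> 'f1 \<times> 'f2 \<Rightarrow> 'b) \<Rightarrow> (nat \<times> nat \<Rightarrow> 'v) \<Rightarrow> real" where
  "seq_ent m g V = ent (law m) (\<lambda>w. (V (fst w), map g (snd w)))"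

definition ent_step :: "nat \<Rightarrow> ('y1 \<times> 'y2 \<times> 'f1 \<times> 'f2 \<Rightarrow> 'b) \<Rightarrow> (nat \<times> nat \<Rightarrow> 'v) \<Rightarrow> real" where
  "ent_step m g V = cent (step m) (\<lambda>w. g (snd w)) (\<lambda>w. (V (fst (fst w)), map g (snd (fst w))))"

lemma law_0: "law 0 = map_pmf (\<lambda>w. (w, [])) msgs"
  by (simp add: code_pmf_def map_pmf_def bind_return_pmf case_prod_unfold)

lemma law_Suc: "law (Suc m) = map_pmf (\<lambda>w. (fst (fst w), snd (fst w) @ [snd w])) (step m)"
  by (simp add: code_pmf_def joint_def map_bind_pmf bind_map_pmf bind_assoc_pmf map_pmf_comp
      case_prod_unfold chan_def inputs_def)

lemma finite_law [simp]: "finite (set_pmf (law m))"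
proof (induction m)
  case 0
  then show ?case using M1 M2 by (simp add: law_0)
next
  case (Suc m)
  then show ?case by (simp add: law_Suc)
qed

lemma map_fst_law: "map_pmf fst (law m) = msgs"
proof -
  have "map_pmf fst (law m) = bind_pmf msgs return_pmf"
    unfolding code_pmf_def by (simp add: map_bind_pmf map_pmf_comp case_prod_unfold)
  then show ?thesis by (simp add: bind_return_pmf')
qed

lemma seq_ent_Suc: "seq_ent (Suc m) g V = seq_ent m g V + ent_step m g V"
proof -
  have "seq_ent (Suc m) g V = ent (step m) (\<lambda>w. (V (fst (fst w)), map g (snd (fst w)) @ [g (snd w)]))"
    by (simp add: seq_ent_def law_Suc ent_map)
  also have "\<dots> = ent (step m) (\<lambda>w. (g (snd w), V (fst (fst w)), map g (snd (fst w))))"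
    by (rule ent_eqI) auto
  also have "\<dots> = ent_step m g V + ent (step m) (\<lambda>w. (V (fst (fst w)), map g (snd (fst w))))"
    by (simp add: ent_step_def cent_def)
  also have "ent (step m) (\<lambda>w. (V (fst (fst w)), map g (snd (fst w)))) =
      ent (map_pmf fst (step m)) (\<lambda>w. (V (fst w), map g (snd w)))"
    unfolding ent_map ..
  finally show ?thesis by (simp add: seq_ent_def)
qed

lemma seq_ent_telescope: "seq_ent n g V = seq_ent 0 g V + (\<Sum>m<n. ent_step m g V)"
  by (induction n) (simp_all add: seq_ent_Suc)

text \<open>The messages and the \<open>g\<close>-part of the past carry no more than the full
  state, and given the full state only the current input matters.\<close>

lemma ent_step_id_ge: "cent (joint (chan ch) (input_law m)) (\<lambda>w. g (snd w)) fst \<le> ent_step m g (\<lambda>w. w)"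
proof -
  have "cent (joint (chan ch) (input_law m)) (\<lambda>w. g (snd w)) fst = cent (step m) (\<lambda>w. g (snd w)) fst"
    by (rule cent_joint_markov[symmetric]) auto
  also have "\<dots> \<le> ent_step m g (\<lambda>w. w)"
    unfolding ent_step_def by (rule cent_mono) auto
  finally show ?thesis .
qed

text \<open>The messages and both feedback sequences determine both inputs, so for
  \<open>fbs\<close> the bound of \<open>ent_step_id_ge\<close> is attained.\<close>

lemma ent_step_id_fbs: "ent_step m fbs (\<lambda>w. w) = cent (joint (chan ch) (input_law m)) (\<lambda>w. fbs (snd w)) fst"
  unfolding ent_step_def
proof (rule cent_joint_markov)
  fix w w' :: "(nat \<times> nat) \<times> ('y1 \<times> 'y2 \<times> 'f1 \<times> 'f2) list"
  assume "(fst w, map fbs (snd w)) = (fst w', map fbs (snd w'))"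
  then show "inputs c m w = inputs c m w'"
    using map_fb_eq[of "snd w" "snd w'"] by (simp add: inputs_def)
qed simp

text \<open>Single-letterization: the known message part and past determine \<open>a\<close> of the
  input, and dropping the rest of the conditioning only raises the first entropy.\<close>

lemma ent_step_le_rate:
  fixes a :: "'x1 \<times> 'x2 \<Rightarrow> 'a" and V :: "nat \<times> nat \<Rightarrow> 'v"
  assumes "\<And>w w'. V (fst w) = V (fst w') \<Longrightarrow> map g (snd w) = map g (snd w') \<Longrightarrow>
      a (inputs c m w) = a (inputs c m w')"
  shows "ent_step m g V - ent_step m g (\<lambda>w. w) \<le> rate (chan ch) a g (input_law m)"
proof -
  have "ent_step m g V \<le> cent (step m) (\<lambda>w. g (snd w)) (\<lambda>w. a (inputs c m (fst w)))"
    unfolding ent_step_def by (rule cent_mono) (simp, rule assms, simp_all)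
  also have "\<dots> = cent (joint (chan ch) (input_law m)) (\<lambda>w. g (snd w)) (\<lambda>w. a (fst w))"
    by (simp flip: map_joint add: cent_map)
  finally show ?thesis using ent_step_id_ge[of m g] by (simp add: rate_def)
qed

text \<open>The past feedback to both transmitters. Together with the instant it forms the label
  \<open>C\<close> hidden by the pad.\<close>

definition history :: "(nat \<times> nat) \<times> ('y1 \<times> 'y2 \<times> 'f1 \<times> 'f2) list \<Rightarrow> ('f1 \<times> 'f2) list" where
  "history w = map fbs (snd w)"

definition cond_input :: "nat \<Rightarrow> ('f1 \<times> 'f2) list \<Rightarrow> ('x1 \<times> 'x2) pmf" where
  "cond_input m h = map_pmf (inputs c m) (cond_pmf (law m) {w. history w = h})"

lemma bind_cond_input: "bind_pmf (map_pmf history (law m)) (cond_input m) = input_law m"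
  unfolding cond_input_def by (rule joint_disintegrate(1)) simp

lemma E_rate_cond_input:
  "pmf_E (map_pmf history (law m)) (\<lambda>h. rate (chan ch) a g (cond_input m h)) =
     cent (step m) (\<lambda>w. g (snd w)) (\<lambda>w. (a (inputs c m (fst w)), history (fst w))) -
     cent (joint (chan ch) (input_law m)) (\<lambda>w. g (snd w)) fst"
  unfolding cond_input_def by (rule joint_disintegrate(2)) simp

text \<open>The history is a function of all past outputs, so conditioning on it instead can only
  raise the entropy.\<close>

lemma ent_step_le_cond_rate:
  "ent_step m (\<lambda>z. z) (\<lambda>_. ()) - ent_step m (\<lambda>z. z) (\<lambda>w. w) \<le>
     pmf_E (map_pmf history (law m)) (\<lambda>h. rate (chan ch) (\<lambda>_. ()) (\<lambda>z. z) (cond_input m h))"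
proof -
  have "ent_step m (\<lambda>z. z) (\<lambda>_. ()) \<le> cent (step m) (\<lambda>w. snd w) (\<lambda>w. ((), history (fst w)))"
    unfolding ent_step_def by (rule cent_mono) (auto simp: history_def)
  then show ?thesis
    unfolding E_rate_cond_input using ent_step_id_ge[of m "\<lambda>z. z"] by simp
qed

text \<open>Message 1 and the history determine X1, and likewise for user 2; this bounds the two
  positive terms. The negative terms match exactly, the last because the history is the past of
  \<open>fbs\<close> itself.\<close>

lemma ent_step_le_cond_balance:
  "ent_step m fbs fst + ent_step m fbs snd - ent_step m fbs (\<lambda>w. w) - ent_step m fbs (\<lambda>_. ()) \<le>
     pmf_E (map_pmf history (law m)) (\<lambda>h. balance (chan ch) fbs (cond_input m h))"
proof -
  have 1: "ent_step m fbs fst \<le> cent (step m) (\<lambda>w. fbs (snd w)) (\<lambda>w. (fst (inputs c m (fst w)), history (fst w)))"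
    unfolding ent_step_def
    by (rule cent_mono) (auto simp: history_def inputs_def dest: map_fb_eq)
  have 2: "ent_step m fbs snd \<le> cent (step m) (\<lambda>w. fbs (snd w)) (\<lambda>w. (snd (inputs c m (fst w)), history (fst w)))"
    unfolding ent_step_def
    by (rule cent_mono) (auto simp: history_def inputs_def dest: map_fb_eq)
  have "pmf_E (map_pmf history (law m)) (\<lambda>h. balance (chan ch) fbs (cond_input m h)) =
     pmf_E (map_pmf history (law m)) (\<lambda>h. rate (chan ch) fst fbs (cond_input m h)) +
     pmf_E (map_pmf history (law m)) (\<lambda>h. rate (chan ch) snd fbs (cond_input m h)) -
     pmf_E (map_pmf history (law m)) (\<lambda>h. rate (chan ch) (\<lambda>_. ()) fbs (cond_input m h))"
    unfolding balance_def by (simp only: pmf_E_diff pmf_E_add finite_law set_map_pmf finite_imageI)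
  also have "\<dots> = cent (step m) (\<lambda>w. fbs (snd w)) (\<lambda>w. (fst (inputs c m (fst w)), history (fst w))) +
     cent (step m) (\<lambda>w. fbs (snd w)) (\<lambda>w. (snd (inputs c m (fst w)), history (fst w))) -
     ent_step m fbs (\<lambda>w. w) - ent_step m fbs (\<lambda>_. ())"
    unfolding E_rate_cond_input ent_step_id_fbs by (simp add: ent_step_def history_def)
  finally show ?thesis using 1 2 by simp
qed

section \<open>Averaging over a uniform instant with its feedback history attached\<close>

definition timed :: "nat \<Rightarrow> (nat \<times> ('f1 \<times> 'f2) list) pmf" where
  "timed n = bind_pmf (pmf_of_set {..<n}) (\<lambda>m. map_pmf (Pair m) (map_pmf history (law m)))"

definition timed_input :: "nat \<times> ('f1 \<times> 'f2) list \<Rightarrow> ('x1 \<times> 'x2) pmf" where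
  "timed_input q = cond_input (fst q) (snd q)"

lemma set_uniform: "0 < n \<Longrightarrow> set_pmf (pmf_of_set {..<n}) = {..<n::nat}"
  by (rule set_pmf_of_set) auto

lemma finite_timed: "0 < n \<Longrightarrow> finite (set_pmf (timed n))"
  by (simp add: timed_def set_uniform)

lemma E_uniform: "0 < n \<Longrightarrow> pmf_E (pmf_of_set {..<n}) f = (\<Sum>m<n. f m) / real n"
  by (subst integral_pmf_of_set) auto

lemma E_timed:
  assumes "0 < n"
  shows "pmf_E (timed n) (\<lambda>q. f (timed_input q)) =
     (\<Sum>m<n. pmf_E (map_pmf history (law m)) (\<lambda>h. f (cond_input m h))) / real n"
  unfolding timed_def timed_input_def using assms
  by (subst pmf_E_bind) (simp_all add: set_uniform E_uniform)

text \<open>Averaging over the history restores the input law of each instant, so the unconditional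
  bounds see only the time average of the input laws.\<close>

lemma bind_timed: "bind_pmf (timed n) timed_input = bind_pmf (pmf_of_set {..<n}) input_law"
  unfolding timed_def
  by (simp add: bind_assoc_pmf bind_map_pmf timed_input_def bind_cond_input[symmetric])

lemma seq_ent_0:
  "seq_ent 0 g (\<lambda>_. ()) = 0" "seq_ent 0 g (\<lambda>w. w) = log 2 M1 + log 2 M2"
  "seq_ent 0 g fst = log 2 M1" "seq_ent 0 g snd = log 2 M2"
proof -
  have 0: "seq_ent 0 g V = ent msgs V" for V :: "nat \<times> nat \<Rightarrow> 'v"
    unfolding seq_ent_def law_0 ent_map by (rule ent_eqI) auto
  have 1: "ent (pmf_of_set {1..M1}) (\<lambda>x. x) = log 2 M1" "ent (pmf_of_set {1..M2}) (\<lambda>x. x) = log 2 M2"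
    using M1 M2 by (simp_all add: ent_pmf_of_set)
  show "seq_ent 0 g (\<lambda>_. ()) = 0" by (simp add: 0)
  have fin: "finite (set_pmf (pmf_of_set {1..M1}))" "finite (set_pmf (pmf_of_set {1..M2}))"
    using M1 M2 by simp_all
  show "seq_ent 0 g (\<lambda>w. w) = log 2 M1 + log 2 M2"
    using ent_pair_pmf[OF fin, of "\<lambda>x. x" "\<lambda>x. x"] unfolding 0 1 by simp
  have "ent msgs fst = ent (map_pmf fst msgs) (\<lambda>x. x)" "ent msgs snd = ent (map_pmf snd msgs) (\<lambda>x. x)"
    unfolding ent_map by simp_all
  then show "seq_ent 0 g fst = log 2 M1" "seq_ent 0 g snd = log 2 M2"
    unfolding 0 map_fst_pair_pmf map_snd_pair_pmf 1 .
qed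

text \<open>With G for the sequence of \<open>g\<close>-values, the left side is I(W1,W2; G | V) /
  n. Telescoping splits it into single uses, and concavity moves the time average inside the
  rate.\<close>

lemma avg_rate_bound:
  fixes a :: "'x1 \<times> 'x2 \<Rightarrow> 'a" and V :: "nat \<times> nat \<Rightarrow> 'v"
  assumes n: "0 < n" and det: "\<And>m w w'. V (fst w) = V (fst w') \<Longrightarrow> map g (snd w) = map g (snd w') \<Longrightarrow>
      a (inputs c m w) = a (inputs c m w')"
  shows "(seq_ent 0 g (\<lambda>w. w) - seq_ent 0 g V - (seq_ent n g (\<lambda>w. w) - seq_ent n g V)) / real n
    \<le> rate (chan ch) a g (bind_pmf (timed n) timed_input)"
proof -
  have "seq_ent 0 g (\<lambda>w. w) - seq_ent 0 g V - (seq_ent n g (\<lambda>w. w) - seq_ent n g V) = (\<Sum>m<n. ent_step m g V - ent_step m g (\<lambda>w. w))"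
    by (simp add: seq_ent_telescope[of n] sum_subtractf)
  also have "\<dots> \<le> (\<Sum>m<n. rate (chan ch) a g (input_law m))"
    by (intro sum_mono ent_step_le_rate) (rule det)
  finally have "(seq_ent 0 g (\<lambda>w. w) - seq_ent 0 g V - (seq_ent n g (\<lambda>w. w) - seq_ent n g V)) / real n \<le>
      pmf_E (pmf_of_set {..<n}) (\<lambda>m. rate (chan ch) a g (input_law m))"
    using n by (simp add: E_uniform divide_right_mono)
  also have "\<dots> \<le> rate (chan ch) a g (bind_pmf (pmf_of_set {..<n}) input_law)"
    using n by (intro rate_concave) (auto simp: set_uniform)
  finally show ?thesis by (simp add: bind_timed)
qed

text \<open>The left side is the information of all outputs about both messages, per use. The label
  stays in the conditioning, so the average is kept outside the rate.\<close>

lemma avg_cond_rate_bound: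
  assumes n: "0 < n"
  shows "(log 2 M1 + log 2 M2 - (seq_ent n (\<lambda>z. z) (\<lambda>w. w) - seq_ent n (\<lambda>z. z) (\<lambda>_. ()))) / real n
    \<le> pmf_E (timed n) (\<lambda>q. rate (chan ch) (\<lambda>_. ()) (\<lambda>z. z) (timed_input q))"
proof -
  have "log 2 M1 + log 2 M2 - (seq_ent n (\<lambda>z. z) (\<lambda>w. w) - seq_ent n (\<lambda>z. z) (\<lambda>_. ())) =
      (\<Sum>m<n. ent_step m (\<lambda>z. z) (\<lambda>_. ()) - ent_step m (\<lambda>z. z) (\<lambda>w. w))"
    by (simp add: seq_ent_telescope[of n] sum_subtractf seq_ent_0)
  also have "\<dots> \<le> (\<Sum>m<n. pmf_E (map_pmf history (law m)) (\<lambda>h. rate (chan ch) (\<lambda>_. ()) (\<lambda>z. z) (cond_input m h)))"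
    by (intro sum_mono ent_step_le_cond_rate)
  finally show ?thesis
    unfolding E_timed[OF n] by (rule divide_right_mono) simp
qed

text \<open>The source is the nonnegativity of I(W1;W2) given both feedback sequences. Telescoping
  compares it with I(W1;W2) before transmission, which is 0 for independent messages.\<close>

lemma avg_cond_balance_nonneg:
  assumes n: "0 < n"
  shows "0 \<le> pmf_E (timed n) (\<lambda>q. balance (chan ch) fbs (timed_input q))"
proof -
  have "seq_ent n fbs (\<lambda>w. w) - seq_ent n fbs snd = cent (law n) (\<lambda>w. fst (fst w)) (\<lambda>w. (snd (fst w), map fbs (snd w)))"
    unfolding seq_ent_def cent_def by (intro arg_cong2[where f="(-)"] ent_eqI) (auto simp: prod_eq_iff)
  also have "\<dots> \<le> cent (law n) (\<lambda>w. fst (fst w)) (\<lambda>w. map fbs (snd w))"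
    by (rule cent_mono) auto
  also have "\<dots> = seq_ent n fbs fst - seq_ent n fbs (\<lambda>_. ())"
    unfolding seq_ent_def cent_def by (intro arg_cong2[where f="(-)"] ent_eqI) auto
  finally have "0 \<le> seq_ent n fbs fst + seq_ent n fbs snd - seq_ent n fbs (\<lambda>w. w) - seq_ent n fbs (\<lambda>_. ())"
    by simp
  also have "\<dots> = (\<Sum>m<n. ent_step m fbs fst + ent_step m fbs snd - ent_step m fbs (\<lambda>w. w) - ent_step m fbs (\<lambda>_. ()))"
    by (simp add: seq_ent_telescope[of n] sum_subtractf sum.distrib seq_ent_0)
  also have "\<dots> \<le> (\<Sum>m<n. pmf_E (map_pmf history (law m)) (\<lambda>h. balance (chan ch) fbs (cond_input m h)))"
    by (intro sum_mono ent_step_le_cond_balance)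
  finally show ?thesis
    unfolding E_timed[OF n] by (rule divide_nonneg_nonneg) simp
qed

section \<open>Fano estimates of the residual message uncertainty\<close>

lemma set_law: "fst ` set_pmf (law m) = {1..M1} \<times> {1..M2}"
proof -
  have "fst ` set_pmf (law m) = set_pmf msgs"
    by (metis map_fst_law set_map_pmf)
  then show ?thesis using M1 M2 by simp
qed

lemma fano1: "cent (law n) (\<lambda>w. fst (fst w)) (\<lambda>w. map out1 (snd w)) \<le> 1 + err1 ch c M1 M2 n * log 2 M1"
proof -
  have "(\<lambda>w. fst (fst w)) ` set_pmf (law n) = fst ` fst ` set_pmf (law n)" by (simp add: image_image)
  also have "\<dots> \<subseteq> {1..M1}" by (auto simp: set_law)
  finally show ?thesis
    using fano[of "law n" "{1..M1}" "\<lambda>w. fst (fst w)" "\<lambda>w. map out1 (snd w)" "dec1 c"]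
    by (simp add: err1_def case_prod_unfold)
qed

lemma fano2: "cent (law n) (\<lambda>w. snd (fst w)) (\<lambda>w. map out2 (snd w)) \<le> 1 + err2 ch c M1 M2 n * log 2 M2"
proof -
  have "(\<lambda>w. snd (fst w)) ` set_pmf (law n) = snd ` fst ` set_pmf (law n)" by (simp add: image_image)
  also have "\<dots> \<subseteq> {1..M2}" by (auto simp: set_law)
  finally show ?thesis
    using fano[of "law n" "{1..M2}" "\<lambda>w. snd (fst w)" "\<lambda>w. map out2 (snd w)" "dec2 c"]
    by (simp add: err2_def case_prod_unfold)
qed

lemma ent_msg_le:
  "ent (law n) (\<lambda>w. fst (fst w)) \<le> log 2 M1" "ent (law n) (\<lambda>w. snd (fst w)) \<le> log 2 M2"
proof -
  have "ent (law n) (\<lambda>w. V (fst w)) = seq_ent 0 (\<lambda>z. z) V" for V :: "nat \<times> nat \<Rightarrow> nat"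
  proof -
    have "ent (law n) (\<lambda>w. V (fst w)) = ent (map_pmf fst (law n)) V" by (simp add: ent_map)
    also have "\<dots> = ent (map_pmf fst (law 0)) V" by (simp only: map_fst_law)
    also have "\<dots> = seq_ent 0 (\<lambda>z. z) V" unfolding seq_ent_def ent_map by (rule ent_eqI) (auto simp: law_0)
    finally show ?thesis .
  qed
  then show "ent (law n) (\<lambda>w. fst (fst w)) \<le> log 2 M1" "ent (law n) (\<lambda>w. snd (fst w)) \<le> log 2 M2"
    by (simp_all add: seq_ent_0)
qed

text \<open>Since \<open>g\<close> contains the output of receiver 1, message 2 and the other
  components of \<open>g\<close> can only sharpen the Fano estimate of decoder 1.\<close>

lemma residual_snd:
  assumes "\<And>z z'. g z = g z' \<Longrightarrow> out1 z = out1 z'"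
  shows "seq_ent n g (\<lambda>w. w) - seq_ent n g snd \<le> 1 + err1 ch c M1 M2 n * log 2 M1"
proof -
  have "seq_ent n g (\<lambda>w. w) - seq_ent n g snd = cent (law n) (\<lambda>w. fst (fst w)) (\<lambda>w. (snd (fst w), map g (snd w)))"
    unfolding seq_ent_def cent_def by (intro arg_cong2[where f="(-)"] ent_eqI) (auto simp: prod_eq_iff)
  also have "\<dots> \<le> cent (law n) (\<lambda>w. fst (fst w)) (\<lambda>w. map out1 (snd w))"
    by (rule cent_mono) (simp, rule map_eq_if_determined[of g, OF _ assms], simp)
  finally show ?thesis using fano1[of n] by simp
qed

lemma residual_fst:
  assumes "\<And>z z'. g z = g z' \<Longrightarrow> out2 z = out2 z'"
  shows "seq_ent n g (\<lambda>w. w) - seq_ent n g fst \<le> 1 + err2 ch c M1 M2 n * log 2 M2"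
proof -
  have "seq_ent n g (\<lambda>w. w) - seq_ent n g fst = cent (law n) (\<lambda>w. snd (fst w)) (\<lambda>w. (fst (fst w), map g (snd w)))"
    unfolding seq_ent_def cent_def by (intro arg_cong2[where f="(-)"] ent_eqI) (auto simp: prod_eq_iff)
  also have "\<dots> \<le> cent (law n) (\<lambda>w. snd (fst w)) (\<lambda>w. map out2 (snd w))"
    by (rule cent_mono) (simp, rule map_eq_if_determined[of g, OF _ assms], simp)
  finally show ?thesis using fano2[of n] by simp
qed

lemma residual_snd_const: "seq_ent n g snd - seq_ent n g (\<lambda>_. ()) = cent (law n) (\<lambda>w. snd (fst w)) (\<lambda>w. map g (snd w))"
  unfolding seq_ent_def cent_def by (intro arg_cong2[where f="(-)"] ent_eqI) auto

lemma residual_fst_const: "seq_ent n g fst - seq_ent n g (\<lambda>_. ()) = cent (law n) (\<lambda>w. fst (fst w)) (\<lambda>w. map g (snd w))"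
  unfolding seq_ent_def cent_def by (intro arg_cong2[where f="(-)"] ent_eqI) auto

text \<open>Message 1 is charged by Fano and message 2 in full. The charge \<open>log 2 M2\<close>
  later cancels against the total message entropy, which leaves a bound on the first rate
  alone.\<close>

lemma residual_out1: "seq_ent n out1 (\<lambda>w. w) - seq_ent n out1 (\<lambda>_. ()) \<le> 1 + err1 ch c M1 M2 n * log 2 M1 + log 2 M2"
proof -
  have "cent (law n) (\<lambda>w. snd (fst w)) (\<lambda>w. map out1 (snd w)) \<le> log 2 M2"
    using cent_le_ent[OF finite_law] ent_msg_le(2) by (rule order_trans)
  with residual_snd[of out1 n] residual_snd_const[of n out1] show ?thesis by simp
qed

lemma residual_out2: "seq_ent n out2 (\<lambda>w. w) - seq_ent n out2 (\<lambda>_. ()) \<le> 1 + err2 ch c M1 M2 n * log 2 M2 + log 2 M1"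
proof -
  have "cent (law n) (\<lambda>w. fst (fst w)) (\<lambda>w. map out2 (snd w)) \<le> log 2 M1"
    using cent_le_ent[OF finite_law] ent_msg_le(1) by (rule order_trans)
  with residual_fst[of out2 n] residual_fst_const[of n out2] show ?thesis by simp
qed

text \<open>By the chain rule message 2 is estimated first, then message 1 given message 2; each use
  of Fano costs one bit, hence the 2.\<close>

lemma residual_both:
  assumes "\<And>z z'. g z = g z' \<Longrightarrow> out1 z = out1 z'" "\<And>z z'. g z = g z' \<Longrightarrow> out2 z = out2 z'"
  shows "seq_ent n g (\<lambda>w. w) - seq_ent n g (\<lambda>_. ()) \<le> 2 + err1 ch c M1 M2 n * log 2 M1 + err2 ch c M1 M2 n * log 2 M2"
proof -
  have "cent (law n) (\<lambda>w. snd (fst w)) (\<lambda>w. map g (snd w)) \<le> cent (law n) (\<lambda>w. snd (fst w)) (\<lambda>w. map out2 (snd w))"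
    by (rule cent_mono) (simp, rule map_eq_if_determined[of g, OF _ assms(2)], simp)
  then show ?thesis
    using residual_snd[where g=g and n=n, OF assms(1)] residual_snd_const[of n g] fano2[of n] by simp
qed

text \<open>The same averaged law from \<open>timed n\<close> serves all bounds at once; the
  residual estimates turn its multi-letter bounds into message rates.\<close>

lemma code_point:
  assumes n: "0 < n"
  obtains v where "v \<in> convex hull range (profile (chan ch) fbs)"
    and "((1 - err1 ch c M1 M2 n) * log 2 M1 - 1) / n \<le> rateV (chan ch) (\<lambda>_. ()) out1 (fst v)"
    and "((1 - err2 ch c M1 M2 n) * log 2 M2 - 1) / n \<le> rateV (chan ch) (\<lambda>_. ()) out2 (fst v)"
    and "((1 - err1 ch c M1 M2 n) * log 2 M1 - 1) / n \<le> rateV (chan ch) snd outs_fb2 (fst v)"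
    and "((1 - err2 ch c M1 M2 n) * log 2 M2 - 1) / n \<le> rateV (chan ch) fst outs_fb1 (fst v)"
    and "((1 - err1 ch c M1 M2 n) * log 2 M1 + (1 - err2 ch c M1 M2 n) * log 2 M2 - 2) / n \<le> fst (snd v)"
    and "((1 - err1 ch c M1 M2 n) * log 2 M1 + (1 - err2 ch c M1 M2 n) * log 2 M2 - 2) / n \<le> rateV (chan ch) (\<lambda>_. ()) outs (fst v)"
    and "0 \<le> snd (snd v)"
proof -
  let ?p = "bind_pmf (timed n) timed_input"
  let ?v = "(pvec ?p, pmf_E (timed n) (\<lambda>q. rate (chan ch) (\<lambda>_. ()) (\<lambda>z. z) (timed_input q)),
     pmf_E (timed n) (\<lambda>q. balance (chan ch) fbs (timed_input q)))"
  have le: "s / real n \<le> r" if "s \<le> t" "t / real n \<le> r" for s t r :: real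
    using divide_right_mono[OF that(1), of "real n"] that(2) by simp
  show thesis
  proof (rule that[of ?v])
    show "?v \<in> convex hull range (profile (chan ch) fbs)"
      by (rule mix_in_hull) (rule finite_timed[OF n])
    show "((1 - err1 ch c M1 M2 n) * log 2 M1 - 1) / n \<le> rateV (chan ch) (\<lambda>_. ()) out1 (fst ?v)" (is "?t / _ \<le> _")
      unfolding fst_conv rate_eq_rateV[symmetric]
    proof (rule le)
      show "?t \<le> seq_ent 0 out1 (\<lambda>w. w) - seq_ent 0 out1 (\<lambda>_. ()) - (seq_ent n out1 (\<lambda>w. w) - seq_ent n out1 (\<lambda>_. ()))"
        using residual_out1[of n] by (simp add: seq_ent_0 algebra_simps)
    qed (rule avg_rate_bound[OF n], simp)
    show "((1 - err2 ch c M1 M2 n) * log 2 M2 - 1) / n \<le> rateV (chan ch) (\<lambda>_. ()) out2 (fst ?v)" (is "?t / _ \<le> _")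
      unfolding fst_conv rate_eq_rateV[symmetric]
    proof (rule le)
      show "?t \<le> seq_ent 0 out2 (\<lambda>w. w) - seq_ent 0 out2 (\<lambda>_. ()) - (seq_ent n out2 (\<lambda>w. w) - seq_ent n out2 (\<lambda>_. ()))"
        using residual_out2[of n] by (simp add: seq_ent_0 algebra_simps)
    qed (rule avg_rate_bound[OF n], simp)
    \<comment> \<open>The sequence of \<open>outs_fb2\<close> contains the feedback to transmitter
      2, which together with message 2 fixes its input.\<close>
    have snd_det: "snd (inputs c m w) = snd (inputs c m w')"
      if "snd (fst w) = snd (fst w')" "map outs_fb2 (snd w) = map outs_fb2 (snd w')" for m w w'
      using that map_eq_if_determined[of outs_fb2 "snd w" "snd w'" fb2] by (simp add: inputs_def outs_fb2_def)
    show "((1 - err1 ch c M1 M2 n) * log 2 M1 - 1) / n \<le> rateV (chan ch) snd outs_fb2 (fst ?v)" (is "?t / _ \<le> _")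
      unfolding fst_conv rate_eq_rateV[symmetric]
    proof (rule le)
      show "?t \<le> seq_ent 0 outs_fb2 (\<lambda>w. w) - seq_ent 0 outs_fb2 snd - (seq_ent n outs_fb2 (\<lambda>w. w) - seq_ent n outs_fb2 snd)"
        using residual_snd[of outs_fb2 n] by (simp add: seq_ent_0 algebra_simps outs_fb2_def)
    qed (rule avg_rate_bound[OF n], rule snd_det)
    have fst_det: "fst (inputs c m w) = fst (inputs c m w')"
      if "fst (fst w) = fst (fst w')" "map outs_fb1 (snd w) = map outs_fb1 (snd w')" for m w w'
      using that map_eq_if_determined[of outs_fb1 "snd w" "snd w'" fb1] by (simp add: inputs_def outs_fb1_def)
    show "((1 - err2 ch c M1 M2 n) * log 2 M2 - 1) / n \<le> rateV (chan ch) fst outs_fb1 (fst ?v)" (is "?t / _ \<le> _")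
      unfolding fst_conv rate_eq_rateV[symmetric]
    proof (rule le)
      show "?t \<le> seq_ent 0 outs_fb1 (\<lambda>w. w) - seq_ent 0 outs_fb1 fst - (seq_ent n outs_fb1 (\<lambda>w. w) - seq_ent n outs_fb1 fst)"
        using residual_fst[of outs_fb1 n] by (simp add: seq_ent_0 algebra_simps outs_fb1_def)
    qed (rule avg_rate_bound[OF n], rule fst_det)
    show "((1 - err1 ch c M1 M2 n) * log 2 M1 + (1 - err2 ch c M1 M2 n) * log 2 M2 - 2) / n \<le> fst (snd ?v)" (is "?t / _ \<le> _")
      unfolding fst_conv snd_conv
    proof (rule le[OF _ avg_cond_rate_bound[OF n]])
      show "?t \<le> log 2 M1 + log 2 M2 - (seq_ent n (\<lambda>z. z) (\<lambda>w. w) - seq_ent n (\<lambda>z. z) (\<lambda>_. ()))"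
        using residual_both[of "\<lambda>z. z" n] by (simp add: algebra_simps)
    qed
    have outs_out: "outs z = outs z' \<Longrightarrow> out1 z = out1 z'" "outs z = outs z' \<Longrightarrow> out2 z = out2 z'"
      for z z' :: "'y1 \<times> 'y2 \<times> 'f1 \<times> 'f2"
      by (simp_all add: outs_def)
    show "((1 - err1 ch c M1 M2 n) * log 2 M1 + (1 - err2 ch c M1 M2 n) * log 2 M2 - 2) / n \<le> rateV (chan ch) (\<lambda>_. ()) outs (fst ?v)" (is "?t / _ \<le> _")
      unfolding fst_conv rate_eq_rateV[symmetric]
    proof (rule le)
      show "?t \<le> seq_ent 0 outs (\<lambda>w. w) - seq_ent 0 outs (\<lambda>_. ()) - (seq_ent n outs (\<lambda>w. w) - seq_ent n outs (\<lambda>_. ()))"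
        using residual_both[where g=outs and n=n, OF outs_out] by (simp add: seq_ent_0 algebra_simps)
    qed (rule avg_rate_bound[OF n], simp)
    show "0 \<le> snd (snd ?v)"
      using avg_cond_balance_nonneg[OF n] by simp
  qed
qed

end

section \<open>From achievable pairs to the closed capacity region\<close>

lemma achievable_point:
  fixes ch :: "('x1::finite, 'x2::finite, 'y1::finite, 'y2::finite, 'f1::finite, 'f2::finite) icgf"
  assumes ach: "achievable ch R1 R2" and \<delta>: "0 < \<delta>"
  obtains v where "v \<in> convex hull range (profile (chan ch) fbs)"
    and "R1 - \<delta> \<le> rateV (chan ch) (\<lambda>_. ()) out1 (fst v)"
    and "R2 - \<delta> \<le> rateV (chan ch) (\<lambda>_. ()) out2 (fst v)"
    and "R1 - \<delta> \<le> rateV (chan ch) snd outs_fb2 (fst v)"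
    and "R2 - \<delta> \<le> rateV (chan ch) fst outs_fb1 (fst v)"
    and "R1 + R2 - \<delta> \<le> fst (snd v)"
    and "R1 + R2 - \<delta> \<le> rateV (chan ch) (\<lambda>_. ()) outs (fst v)"
    and "0 \<le> snd (snd v)"
proof -
  have R: "0 \<le> R1" "0 \<le> R2" using ach by (auto simp: achievable_def)
  \<comment> \<open>Decoding errors may cost \<open>\<delta> / 2\<close> of the sum rate, the other
    half is left for the Fano constants. The cap at 1 keeps \<open>1 - \<epsilon>\<close>
    nonnegative.\<close>
  define \<epsilon> where "\<epsilon> = min 1 (\<delta> / (2 * (R1 + R2 + 1)))"
  have \<epsilon>: "0 < \<epsilon>" "\<epsilon> \<le> 1" using \<delta> R by (auto simp: \<epsilon>_def)
  have "\<epsilon> * (R1 + R2 + 1) \<le> \<delta> / (2 * (R1 + R2 + 1)) * (R1 + R2 + 1)"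
    using R by (intro mult_right_mono) (auto simp: \<epsilon>_def)
  also have "\<dots> = \<delta> / 2" using R by (simp add: field_simps add_nonneg_eq_0_iff)
  finally have \<epsilon>R: "\<epsilon> * R1 + \<epsilon> * R2 \<le> \<delta> / 2" using \<epsilon> by (simp add: algebra_simps)
  \<comment> \<open>At such block lengths the Fano constant 2 costs at most
    \<open>\<delta> / 2\<close> per use.\<close>
  have "\<forall>\<^sub>F n in sequentially. 4 / \<delta> \<le> real n"
    by real_asymp
  moreover have "\<forall>\<^sub>F n in sequentially. \<exists>M1 M2 P1 P2 c. is_code ch n M1 M2 P1 P2 c \<and>
        R1 \<le> log 2 (real M1) / real n \<and> R2 \<le> log 2 (real M2) / real n \<and> P1 \<le> \<epsilon> \<and> P2 \<le> \<epsilon>"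
    using ach \<epsilon> by (auto simp: achievable_def)
  ultimately obtain n where n: "4 / \<delta> \<le> real n" and "\<exists>M1 M2 P1 P2 c. is_code ch n M1 M2 P1 P2 c \<and>
        R1 \<le> log 2 (real M1) / real n \<and> R2 \<le> log 2 (real M2) / real n \<and> P1 \<le> \<epsilon> \<and> P2 \<le> \<epsilon>"
    using eventually_happens'[OF sequentially_bot eventually_conj] by blast
  then obtain M1 M2 P1 P2 c where code: "is_code ch n M1 M2 P1 P2 c"
    and rate: "R1 \<le> log 2 (real M1) / real n" "R2 \<le> log 2 (real M2) / real n"
    and P: "P1 \<le> \<epsilon>" "P2 \<le> \<epsilon>" by blast
  have "0 < 4 / \<delta>" using \<delta> by simp
  then have n_pos: "0 < n" using n by linarith
  have M: "1 \<le> M1" "1 \<le> M2"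
    using code by (auto simp: is_code_def)
  let ?err1 = "err1 ch c M1 M2 n" and ?err2 = "err2 ch c M1 M2 n"
  have err: "?err1 \<le> \<epsilon>" "?err2 \<le> \<epsilon>"
    using code P by (auto simp: is_code_def err1_def err2_def)
  have inv_n: "2 / real n \<le> \<delta> / 2"
    using n \<delta> n_pos by (simp add: field_simps)
  have inv_n': "1 / real n \<le> 2 / real n" by (simp add: divide_right_mono)
  have key: "r - \<epsilon> * r \<le> (1 - p) * L / real n" if "0 \<le> r" "r \<le> L / real n" "p \<le> \<epsilon>" for r L p
  proof -
    have "(1 - \<epsilon>) * r \<le> (1 - p) * (L / real n)"
      using that \<epsilon> by (intro mult_mono) auto
    then show ?thesis by (simp add: algebra_simps)
  qed
  note key1 = key[OF R(1) rate(1) err(1)] and key2 = key[OF R(2) rate(2) err(2)]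
  have nn: "0 \<le> \<epsilon> * R1" "0 \<le> \<epsilon> * R2" using \<epsilon> R by simp_all
  have 1: "R1 - \<delta> \<le> ((1 - ?err1) * log 2 M1 - 1) / n"
    using key1 \<epsilon>R nn inv_n inv_n' unfolding diff_divide_distrib by linarith
  have 2: "R2 - \<delta> \<le> ((1 - ?err2) * log 2 M2 - 1) / n"
    using key2 \<epsilon>R nn inv_n inv_n' unfolding diff_divide_distrib by linarith
  have 3: "R1 + R2 - \<delta> \<le> ((1 - ?err1) * log 2 M1 + (1 - ?err2) * log 2 M2 - 2) / n"
    using key1 key2 \<epsilon>R inv_n unfolding diff_divide_distrib add_divide_distrib by linarith
  from code_point[where ch=ch and c=c, OF M n_pos] obtain v where v: "v \<in> convex hull range (profile (chan ch) fbs)"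
    "((1 - ?err1) * log 2 M1 - 1) / n \<le> rateV (chan ch) (\<lambda>_. ()) out1 (fst v)"
    "((1 - ?err2) * log 2 M2 - 1) / n \<le> rateV (chan ch) (\<lambda>_. ()) out2 (fst v)"
    "((1 - ?err1) * log 2 M1 - 1) / n \<le> rateV (chan ch) snd outs_fb2 (fst v)"
    "((1 - ?err2) * log 2 M2 - 1) / n \<le> rateV (chan ch) fst outs_fb1 (fst v)"
    "((1 - ?err1) * log 2 M1 + (1 - ?err2) * log 2 M2 - 2) / n \<le> fst (snd v)"
    "((1 - ?err1) * log 2 M1 + (1 - ?err2) * log 2 M2 - 2) / n \<le> rateV (chan ch) (\<lambda>_. ()) outs (fst v)"
    "0 \<le> snd (snd v)" .
  show thesis
    by (rule that[OF v(1)])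
       (fact order_trans[OF 1 v(2)] order_trans[OF 2 v(3)] order_trans[OF 1 v(4)] order_trans[OF 2 v(5)]
             order_trans[OF 3 v(6)] order_trans[OF 3 v(7)] v(8))+
qed

lemma capacity_region_near:
  assumes "(R1, R2) \<in> capacity_region ch" "0 < \<delta>"
  obtains R1' R2' where "achievable ch R1' R2'" "\<bar>R1 - R1'\<bar> < \<delta>" "\<bar>R2 - R2'\<bar> < \<delta>"
proof -
  from assms obtain R1' R2' where ach: "achievable ch R1' R2'" and d: "dist (R1', R2') (R1, R2) < \<delta>"
    unfolding capacity_region_def closure_approachable by blast
  have "dist R1' R1 < \<delta>" "dist R2' R2 < \<delta>"
    using dist_fst_le[of "(R1', R2')" "(R1, R2)"] dist_snd_le[of "(R1', R2')" "(R1, R2)"] d by simp_all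
  then show thesis
    using ach that[of R1' R2'] by (simp add: dist_real_def abs_minus_commute)
qed

lemma capacity_region_nonneg:
  assumes "(R1, R2) \<in> capacity_region ch"
  shows "0 \<le> R1" "0 \<le> R2"
proof -
  have "0 \<le> R1 + \<delta> \<and> 0 \<le> R2 + \<delta>" if \<delta>: "0 < \<delta>" for \<delta>
  proof -
    obtain R1' R2' where R': "achievable ch R1' R2'" "\<bar>R1 - R1'\<bar> < \<delta>" "\<bar>R2 - R2'\<bar> < \<delta>"
      by (rule capacity_region_near[OF assms \<delta>])
    then have "0 \<le> R1'" "0 \<le> R2'" by (simp_all add: achievable_def)
    with R' show ?thesis by linarith
  qed
  then show "0 \<le> R1" "0 \<le> R2" by (auto intro: field_le_epsilon)
qed

lemma continuous_on_hull_rateV: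
  "continuous_on (convex hull range (profile W f)) (\<lambda>v. rateV W a g (fst v) - r)"
  by (intro continuous_on_diff continuous_on_const
      continuous_on_compose2[OF continuous_on_rateV continuous_on_fst[OF continuous_on_id]])
     (auto dest: hull_profile_simplex)

lemma capacity_region_approx:
  fixes ch :: "('x1::finite, 'x2::finite, 'y1::finite, 'y2::finite, 'f1::finite, 'f2::finite) icgf"
  assumes cap: "(R1, R2) \<in> capacity_region ch" and "0 < \<delta>"
  obtains v where "v \<in> convex hull range (profile (chan ch) fbs)"
    and "R1 - \<delta> \<le> rateV (chan ch) (\<lambda>_. ()) out1 (fst v)"
    and "R2 - \<delta> \<le> rateV (chan ch) (\<lambda>_. ()) out2 (fst v)"
    and "R1 - \<delta> \<le> rateV (chan ch) snd outs_fb2 (fst v)"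
    and "R2 - \<delta> \<le> rateV (chan ch) fst outs_fb1 (fst v)"
    and "R1 + R2 - \<delta> \<le> fst (snd v)"
    and "R1 + R2 - \<delta> \<le> rateV (chan ch) (\<lambda>_. ()) outs (fst v)"
    and "0 \<le> snd (snd v)"
proof -
  \<comment> \<open>One third for each rate perturbation and one for the code; the sum-rate bound
    spends all three.\<close>
  have \<delta>: "0 < \<delta> / 3" using \<open>0 < \<delta>\<close> by simp
  obtain R1' R2' where ach: "achievable ch R1' R2'"
    and R': "\<bar>R1 - R1'\<bar> < \<delta> / 3" "\<bar>R2 - R2'\<bar> < \<delta> / 3"
    by (rule capacity_region_near[OF cap \<delta>])
  have le: "R1 - \<delta> \<le> R1' - \<delta> / 3" "R2 - \<delta> \<le> R2' - \<delta> / 3" "R1 + R2 - \<delta> \<le> R1' + R2' - \<delta> / 3"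
    using R' \<delta> by linarith+
  show thesis
    by (rule achievable_point[OF ach \<delta>], rule that, assumption)
       ((rule order_trans[OF le(1)] order_trans[OF le(2)] order_trans[OF le(3)], assumption)+, assumption)
qed

lemma capacity_region_point:
  fixes ch :: "('x1::finite, 'x2::finite, 'y1::finite, 'y2::finite, 'f1::finite, 'f2::finite) icgf"
  assumes cap: "(R1, R2) \<in> capacity_region ch"
  obtains v where "v \<in> convex hull range (profile (chan ch) fbs)"
    and "R1 \<le> rateV (chan ch) (\<lambda>_. ()) out1 (fst v)"
    and "R2 \<le> rateV (chan ch) (\<lambda>_. ()) out2 (fst v)"
    and "R1 \<le> rateV (chan ch) snd outs_fb2 (fst v)"
    and "R2 \<le> rateV (chan ch) fst outs_fb1 (fst v)"
    and "R1 + R2 \<le> fst (snd v)"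
    and "R1 + R2 \<le> rateV (chan ch) (\<lambda>_. ()) outs (fst v)"
    and "0 \<le> snd (snd v)"
proof -
  let ?W = "chan ch"
  let ?K = "convex hull range (profile ?W fbs)"
  \<comment> \<open>The bounds as slack functions in one family, so that a single limit point
    satisfies them together.\<close>
  let ?F = "{\<lambda>v. rateV ?W (\<lambda>_. ()) out1 (fst v) - R1, \<lambda>v. rateV ?W (\<lambda>_. ()) out2 (fst v) - R2,
    \<lambda>v. rateV ?W snd outs_fb2 (fst v) - R1, \<lambda>v. rateV ?W fst outs_fb1 (fst v) - R2,
    \<lambda>v. fst (snd v) - (R1 + R2), \<lambda>v. rateV ?W (\<lambda>_. ()) outs (fst v) - (R1 + R2), \<lambda>v. snd (snd v)}"
  have "\<exists>v\<in>?K. \<forall>f\<in>?F. 0 \<le> f v"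
  proof (rule compact_approx_exact)
    show "compact ?K" by (intro compact_convex_hull compact_range_profile)
    have cont: "continuous_on ?K (\<lambda>v. fst (snd v) - (R1 + R2))" "continuous_on ?K (\<lambda>v. snd (snd v))"
      by (intro continuous_intros)+
    show "\<forall>f\<in>?F. continuous_on ?K f"
      by (simp only: Set.ball_simps simp_thms continuous_on_hull_rateV cont)
    fix \<delta> :: real assume \<delta>: "0 < \<delta>"
    obtain v where v: "v \<in> ?K"
      "R1 - \<delta> \<le> rateV ?W (\<lambda>_. ()) out1 (fst v)" "R2 - \<delta> \<le> rateV ?W (\<lambda>_. ()) out2 (fst v)"
      "R1 - \<delta> \<le> rateV ?W snd outs_fb2 (fst v)" "R2 - \<delta> \<le> rateV ?W fst outs_fb1 (fst v)"
      "R1 + R2 - \<delta> \<le> fst (snd v)" "R1 + R2 - \<delta> \<le> rateV ?W (\<lambda>_. ()) outs (fst v)"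
      "0 \<le> snd (snd v)"
      by (rule capacity_region_approx[OF cap \<delta>])
    have "\<forall>f\<in>?F. - \<delta> \<le> f v"
      unfolding Set.ball_simps using v(2-) \<delta> by (intro conjI TrueI; linarith)
    then show "\<exists>v\<in>?K. \<forall>f\<in>?F. - \<delta> \<le> f v"
      using v(1) by (rule bexI[of "\<lambda>v. \<forall>f\<in>?F. - \<delta> \<le> f v" v])
  qed
  then obtain v where v: "v \<in> ?K" "\<forall>f\<in>?F. 0 \<le> f v" by (elim bexE)
  from v(2) have bounds: "R1 \<le> rateV ?W (\<lambda>_. ()) out1 (fst v)" "R2 \<le> rateV ?W (\<lambda>_. ()) out2 (fst v)"
    "R1 \<le> rateV ?W snd outs_fb2 (fst v)" "R2 \<le> rateV ?W fst outs_fb1 (fst v)"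
    "R1 + R2 \<le> fst (snd v)" "R1 + R2 \<le> rateV ?W (\<lambda>_. ()) outs (fst v)" "0 \<le> snd (snd v)"
    unfolding Set.ball_simps by linarith+
  show thesis
    by (rule that[OF v(1) bounds])
qed

subsection \<open>Mutual information on finite alphabets\<close>

text \<open>A finite set replaces a finite type here because the auxiliary variables take real
  values.\<close>

lemma distributed_pmf_count_space:
  assumes A: "finite A" "\<And>w. X w \<in> A"
  shows "distributed (measure_pmf q) (count_space A) X (\<lambda>x. ennreal (pmf (map_pmf X q) x))"
  unfolding distributed_def
proof (intro conjI)
  show X: "X \<in> measurable (measure_pmf q) (count_space A)"
    using A by simp
  show "distr (measure_pmf q) (count_space A) X =
      density (count_space A) (\<lambda>x. ennreal (pmf (map_pmf X q) x))"
  proof (rule measure_eqI_finite[of _ A])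
    fix a assume a: "a \<in> A"
    have "emeasure (distr (measure_pmf q) (count_space A) X) {a} = emeasure (measure_pmf q) (X -` {a})"
      using X a by (subst emeasure_distr) auto
    also have "\<dots> = ennreal (pmf (map_pmf X q) a)"
      by (simp add: pmf_map measure_pmf.emeasure_eq_measure)
    also have "\<dots> = (\<Sum>x\<in>A. if x = a then ennreal (pmf (map_pmf X q) x) else 0)"
      using A a by (simp only: sum.delta if_True)
    also have "\<dots> = (\<Sum>x\<in>A. ennreal (pmf (map_pmf X q) x) * indicator {a} x)"
      by (intro sum.cong) (auto simp: indicator_def)
    also have "\<dots> = emeasure (density (count_space A) (\<lambda>x. ennreal (pmf (map_pmf X q) x))) {a}"
      using A a by (simp only: emeasure_density nn_integral_count_space_finite borel_measurable_count_space
          sets_count_space Pow_iff insert_subset empty_subsetI simp_thms)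
    finally show "emeasure (distr (measure_pmf q) (count_space A) X) {a} =
        emeasure (density (count_space A) (\<lambda>x. ennreal (pmf (map_pmf X q) x))) {a}" .
  qed (use A in auto)
qed simp

text \<open>Densities with respect to counting measure are point probabilities, so mutual
  information is the mean of a log ratio, which splits into entropies.\<close>

lemma mutual_information_pmf:
  assumes q: "finite (set_pmf q)"
    and A: "finite A" "\<And>w. X w \<in> A" and B: "finite B" "\<And>w. Y w \<in> B"
  shows "prob_space.mutual_information (measure_pmf q) 2 (count_space A) (count_space B) X Y =
    ent q X + ent q Y - ent q (\<lambda>w. (X w, Y w))"
proof -
  interpret information_space "measure_pmf q" 2
    by unfold_locales simp
  let ?XY = "\<lambda>w. (X w, Y w)"
  let ?h = "\<lambda>v. log 2 (pmf (map_pmf ?XY q) v / (pmf (map_pmf X q) (fst v) * pmf (map_pmf Y q) (snd v)))"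
  have AB: "count_space A \<Otimes>\<^sub>M count_space B = count_space (A \<times> B)"
    using A B by (intro pair_measure_count_space)
  have "prob_space.mutual_information (measure_pmf q) 2 (count_space A) (count_space B) X Y =
      integral\<^sup>L (count_space A \<Otimes>\<^sub>M count_space B) (\<lambda>v. pmf (map_pmf ?XY q) v * ?h v)"
  proof (rule mutual_information_distr)
    show "distributed (measure_pmf q) (count_space A \<Otimes>\<^sub>M count_space B) ?XY (\<lambda>x. ennreal (pmf (map_pmf ?XY q) x))"
      unfolding AB using A B by (intro distributed_pmf_count_space) auto
  qed (use A B in \<open>auto intro: distributed_pmf_count_space sigma_finite_measure_count_space_finite\<close>)
  also have "\<dots> = (\<Sum>v\<in>A \<times> B. pmf (map_pmf ?XY q) v * ?h v)"
    unfolding AB using A B by (intro lebesgue_integral_count_space_finite) auto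
  also have "\<dots> = pmf_E (map_pmf ?XY q) ?h"
    using A B by (subst integral_measure_pmf_real[of "A \<times> B"]) (auto simp: mult.commute)
  also have "\<dots> = pmf_E q (\<lambda>w. ?h (?XY w))"
    by simp
  also have "\<dots> = pmf_E q (\<lambda>w. - log 2 (pmf (map_pmf X q) (X w)) + - log 2 (pmf (map_pmf Y q) (Y w))
      - - log 2 (pmf (map_pmf ?XY q) (?XY w)))"
  proof (rule pmf_E_cong)
    fix w assume w: "w \<in> set_pmf q"
    then show "?h (?XY w) = - log 2 (pmf (map_pmf X q) (X w)) + - log 2 (pmf (map_pmf Y q) (Y w))
      - - log 2 (pmf (map_pmf ?XY q) (?XY w))"
      using pmf_map_pos[OF w, of X] pmf_map_pos[OF w, of Y] pmf_map_pos[OF w, of ?XY]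
      by (simp add: log_divide log_mult)
  qed
  also have "\<dots> = ent q X + ent q Y - ent q ?XY"
    unfolding ent_def using q by (simp only: pmf_E_diff pmf_E_add)
  finally show ?thesis .
qed

lemma mi_pmf:
  fixes X :: "'w \<Rightarrow> 'a::finite" and Y :: "'w \<Rightarrow> 'b::finite"
  assumes q: "finite (set_pmf q)"
  shows "mi (measure_pmf q) X Y = ent q Y - cent q Y X"
proof -
  have "ent q (\<lambda>w. (X w, Y w)) = ent q (\<lambda>w. (Y w, X w))"
    by (rule ent_eqI) auto
  then show ?thesis
    unfolding mi_def cent_def using q by (subst mutual_information_pmf) auto
qed

lemma cmi_pmf:
  fixes X :: "'w \<Rightarrow> 'a::finite" and Y :: "'w \<Rightarrow> 'b::finite"
  assumes q: "finite (set_pmf q)" and C: "finite C" "\<And>w. Z w \<in> C"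
  shows "cmi (measure_pmf q) (count_space C) X Y Z = cent q Y Z - cent q Y (\<lambda>w. (X w, Z w))"
proof -
  have UC: "count_space UNIV \<Otimes>\<^sub>M count_space C = count_space ((UNIV :: 'b set) \<times> C)"
    using C by (intro pair_measure_count_space) auto
  have "cmi (measure_pmf q) (count_space C) X Y Z =
     (ent q X + ent q (\<lambda>w. (Y w, Z w)) - ent q (\<lambda>w. (X w, Y w, Z w))) -
     (ent q X + ent q Z - ent q (\<lambda>w. (X w, Z w)))"
    unfolding cmi_def prob_space.conditional_mutual_information_def[OF measure_pmf.prob_space_axioms] UC
    using q C by (subst (1 2) mutual_information_pmf) auto
  moreover have "ent q (\<lambda>w. (X w, Y w, Z w)) = ent q (\<lambda>w. (Y w, X w, Z w))"
    by (rule ent_eqI) auto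
  ultimately show ?thesis by (simp add: cent_def)
qed

text \<open>By symmetry of information the entropies of \<open>X\<close>, \<open>Y\<close> and
  \<open>Z\<close> alone cancel, and only feedback entropies remain, as in
  \<open>balance\<close>.\<close>

lemma cmi_diff_pmf:
  fixes X :: "'w \<Rightarrow> 'a::finite" and Y :: "'w \<Rightarrow> 'b::finite"
  assumes q: "finite (set_pmf q)" and C: "finite C" "\<And>w. Z w \<in> C"
    and D: "finite D" "\<And>w. (F1 w, F2 w, Z w) \<in> D"
  shows "cmi (measure_pmf q) (count_space D) X Y (\<lambda>w. (F1 w, F2 w, Z w)) -
      cmi (measure_pmf q) (count_space C) X Y Z =
    cent q (\<lambda>w. (F1 w, F2 w)) (\<lambda>w. (X w, Z w)) + cent q (\<lambda>w. (F1 w, F2 w)) (\<lambda>w. (Y w, Z w)) -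
    cent q (\<lambda>w. (F1 w, F2 w)) (\<lambda>w. ((X w, Y w), Z w)) - cent q (\<lambda>w. (F1 w, F2 w)) Z"
proof -
  have "ent q (\<lambda>w. (Y w, F1 w, F2 w, Z w)) = ent q (\<lambda>w. ((F1 w, F2 w), Y w, Z w))"
    "ent q (\<lambda>w. (F1 w, F2 w, Z w)) = ent q (\<lambda>w. ((F1 w, F2 w), Z w))"
    "ent q (\<lambda>w. (Y w, X w, F1 w, F2 w, Z w)) = ent q (\<lambda>w. ((F1 w, F2 w), (X w, Y w), Z w))"
    "ent q (\<lambda>w. (X w, F1 w, F2 w, Z w)) = ent q (\<lambda>w. ((F1 w, F2 w), X w, Z w))"
    "ent q (\<lambda>w. (Y w, X w, Z w)) = ent q (\<lambda>w. ((X w, Y w), Z w))"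
    by (rule ent_eqI; auto)+
  then show ?thesis
    by (simp add: cmi_pmf[OF q C] cmi_pmf[OF q D] cent_def)
qed

section \<open>Independent components and shifts modulo \<open>N\<close>\<close>

lemma cent_pair_indep:
  assumes "finite (set_pmf p)" "finite (set_pmf q)"
  shows "cent (pair_pmf p q) (\<lambda>w. X (fst w)) (\<lambda>w. (Y (fst w), Z (snd w))) = cent p X Y"
proof -
  have "ent (pair_pmf p q) (\<lambda>w. (X (fst w), Y (fst w), Z (snd w))) =
      ent (pair_pmf p q) (\<lambda>w. ((X (fst w), Y (fst w)), Z (snd w)))"
    by (rule ent_eqI) auto
  also have "\<dots> = ent p (\<lambda>w. (X w, Y w)) + ent q Z"
    using ent_pair_pmf[OF assms, of "\<lambda>w. (X w, Y w)" Z] by simp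
  finally show ?thesis
    unfolding cent_def ent_pair_pmf[OF assms] by simp
qed

lemma prob_joint_rect:
  fixes V :: "'g \<Rightarrow> 'z::finite pmf"
  assumes G: "finite (set_pmf G)" and B: "\<And>g. g \<in> B \<Longrightarrow> V g = v"
  shows "measure_pmf.prob (joint V G) {w. fst w \<in> B \<and> snd w = z} = measure_pmf.prob G B * pmf v z"
proof -
  have "measure_pmf.prob (joint V G) {w. fst w \<in> B \<and> snd w = z} =
      pmf_E (joint V G) (indicator {w. fst w \<in> B \<and> snd w = z})"
    by simp
  also have "\<dots> = pmf_E G (\<lambda>g. pmf_E (V g) (\<lambda>y. indicator {w. fst w \<in> B \<and> snd w = z} (g, y)))"
    unfolding joint_def
    by (subst pmf_E_bind)
       (use G in \<open>simp_all only: integral_map_pmf set_map_pmf finite finite_imageI\<close>)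
  also have "\<dots> = pmf_E G (\<lambda>g. indicator B g * pmf v z)"
  proof (rule pmf_E_cong)
    fix g
    have "pmf_E (V g) (\<lambda>y. indicator {w. fst w \<in> B \<and> snd w = z} (g, y)) =
        pmf_E (V g) (\<lambda>y. indicator B g * indicator {z} y)"
      by (intro pmf_E_cong) (auto simp: indicator_def)
    also have "\<dots> = indicator B g * pmf (V g) z"
      by (simp add: measure_pmf_single)
    finally show "pmf_E (V g) (\<lambda>y. indicator {w. fst w \<in> B \<and> snd w = z} (g, y)) = indicator B g * pmf v z"
      using B[of g] by (auto simp: indicator_def)
  qed
  finally show ?thesis by simp
qed

lemma add_mod_cancel:
  fixes c u u' N :: nat
  assumes "(c + u) mod N = (c + u') mod N" "u < N" "u' < N"
  shows "u = u'"
proof -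
  from assms(1) obtain a b where "c + u + N * a = c + u' + N * b"
    unfolding nat_mod_eq_iff by blast
  then have "u mod N = u' mod N"
    unfolding nat_mod_eq_iff by (metis add.assoc add_left_cancel)
  then show ?thesis using assms by simp
qed

text \<open>A shift is an injective self-map of a finite set, hence a bijection. This is the secrecy
  of the pad.\<close>

lemma map_uniform_shift:
  assumes "0 < N"
  shows "map_pmf (\<lambda>u. (c + u) mod N) (pmf_of_set {..<N}) = pmf_of_set {..<N::nat}"
proof (rule map_pmf_of_set_bij_betw)
  have inj: "inj_on (\<lambda>u. (c + u) mod N) {..<N}"
    by (rule inj_onI) (auto intro: add_mod_cancel)
  moreover have "(\<lambda>u. (c + u) mod N) ` {..<N} \<subseteq> {..<N}" using assms by auto
  ultimately show "bij_betw (\<lambda>u. (c + u) mod N) {..<N} {..<N}"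
    by (simp add: bij_betw_def endo_inj_surj)
qed (use assms in auto)

subsection \<open>The one-time pad\<close>

definition tag1 :: "(nat \<times> 'r) \<times> nat \<Rightarrow> nat" where
  "tag1 w = snd w"

definition tag2 :: "nat \<Rightarrow> (nat \<times> 'r) \<times> nat \<Rightarrow> nat" where
  "tag2 N w = (fst (fst w) + snd w) mod N"

context
  fixes W :: "'x \<Rightarrow> 'z::finite pmf" and m :: "nat pmf" and k :: "nat \<Rightarrow> 'x pmf" and N :: nat
  assumes fin_m: "finite (set_pmf m)" and fin_k: "\<And>c. c \<in> set_pmf m \<Longrightarrow> finite (set_pmf (k c))"
    and N: "set_pmf m \<subseteq> {..<N}"
begin

abbreviation "unif \<equiv> pmf_of_set {..<N}"
abbreviation "mix \<equiv> bind_pmf m (\<lambda>c. map_pmf (Pair c) (joint W (k c)))"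
abbreviation "padded \<equiv> pair_pmf mix unif"
abbreviation "avg \<equiv> joint W (bind_pmf m k)"

lemma N_pos: "0 < N"
  using N set_pmf_not_empty[of m] by (cases N) auto

lemma finite_mix [simp]: "finite (set_pmf mix)"
  using fin_m fin_k by auto

lemma set_unif: "set_pmf unif = {..<N}"
  by (rule set_pmf_of_set) (use N_pos in auto)

lemma finite_unif [simp]: "finite (set_pmf unif)"
  by (simp add: set_unif)

lemma finite_padded [simp]: "finite (set_pmf padded)"
  by (simp only: set_pair_pmf finite_cartesian_product finite_mix finite_unif)

lemma finite_avg [simp]: "finite (set_pmf avg)"
  using fin_m fin_k by auto

lemma padded_tag1: "map_pmf (\<lambda>w. (snd (fst w), tag1 w)) padded = pair_pmf avg unif"
  by (simp add: tag1_def map_snd_mix_joint[symmetric] pair_map_pmf1 apfst_def map_prod_def case_prod_unfold)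

text \<open>For each fixed label the shifted pad is again uniform, so the label drops out and
  \<open>tag2\<close> is independent of the channel variables.\<close>

lemma padded_tag2: "map_pmf (\<lambda>w. (snd (fst w), tag2 N w)) padded = pair_pmf avg unif"
proof -
  have "map_pmf (\<lambda>w. (snd (fst w), tag2 N w)) padded =
      bind_pmf mix (\<lambda>r. map_pmf (Pair (snd r)) (map_pmf (\<lambda>u. (fst r + u) mod N) unif))"
    by (simp add: tag2_def pair_pmf_def map_bind_pmf map_pmf_comp map_pmf_def[symmetric])
  also have "\<dots> = bind_pmf mix (\<lambda>r. map_pmf (Pair (snd r)) unif)"
    by (simp only: map_uniform_shift[OF N_pos])
  also have "\<dots> = pair_pmf (map_pmf snd mix) unif"
    by (simp add: pair_pmf_def map_pmf_def[symmetric] bind_map_pmf)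
  finally show ?thesis by (simp only: map_snd_mix_joint)
qed

lemma cent_no_tag: "cent padded (\<lambda>w. X (snd (fst w))) (\<lambda>w. Y (snd (fst w))) = cent avg X Y"
proof -
  have "avg = map_pmf (\<lambda>w. snd (fst w)) padded"
    unfolding map_snd_mix_joint[symmetric] by (simp add: map_pmf_comp[symmetric] map_fst_pair_pmf)
  then show ?thesis by (simp only: cent_map)
qed

lemma cent_tag1:
  "cent padded (\<lambda>w. X (snd (fst w))) (\<lambda>w. (Y (snd (fst w)), tag1 w)) = cent avg X Y"
  using cent_pair_indep[OF finite_avg finite_unif, of X Y "\<lambda>u. u"]
  by (simp only: padded_tag1[symmetric] cent_map fst_conv snd_conv)

lemma cent_tag2:
  "cent padded (\<lambda>w. X (snd (fst w))) (\<lambda>w. (Y (snd (fst w)), tag2 N w)) = cent avg X Y"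
  using cent_pair_indep[OF finite_avg finite_unif, of X Y "\<lambda>u. u"]
  by (simp only: padded_tag2[symmetric] cent_map fst_conv snd_conv)

lemma set_padded: "w \<in> set_pmf padded \<Longrightarrow> fst (fst w) < N \<and> snd w < N"
  using N by (auto simp: set_unif)

text \<open>On the support labels lie below \<open>N\<close>, so the two tags together reveal the
  label; the pad that remains is independent and drops out.\<close>

lemma cent_tags:
  "cent padded (\<lambda>w. X (snd (fst w))) (\<lambda>w. (Y (snd (fst w)), tag1 w, tag2 N w)) =
   cent mix (\<lambda>r. X (snd r)) (\<lambda>r. (Y (snd r), fst r))"
proof -
  have "cent padded (\<lambda>w. X (snd (fst w))) (\<lambda>w. (Y (snd (fst w)), tag1 w, tag2 N w)) =
      cent padded (\<lambda>w. X (snd (fst w))) (\<lambda>w. ((Y (snd (fst w)), fst (fst w)), snd w))"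
  proof (rule cent_eqI)
    fix w w' assume "w \<in> set_pmf padded" "w' \<in> set_pmf padded"
    then have "fst (fst w) < N" "fst (fst w') < N" using set_padded by blast+
    then show "(Y (snd (fst w)), tag1 w, tag2 N w) = (Y (snd (fst w')), tag1 w', tag2 N w') \<longleftrightarrow>
        ((Y (snd (fst w)), fst (fst w)), snd w) = ((Y (snd (fst w')), fst (fst w')), snd w')"
      using add_mod_cancel[of "snd w" "fst (fst w)" N "fst (fst w')"]
      by (auto simp: tag1_def tag2_def add.commute)
  qed simp
  also have "\<dots> = cent mix (\<lambda>r. X (snd r)) (\<lambda>r. (Y (snd r), fst r))"
    using cent_pair_indep[OF finite_mix finite_unif, of "\<lambda>r. X (snd r)" "\<lambda>r. (Y (snd r), fst r)" "\<lambda>u. u"]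
    by simp
  finally show ?thesis .
qed

text \<open>For the identity \<open>a\<close> the rate is 0, so \<open>rate_mix\<close> shows that
  the label adds nothing once the input is known. This brings both terms onto the labelled
  mixture.\<close>

lemma cent_mix_eq_E_rate:
  "cent mix (\<lambda>r. g (snd (snd r))) (\<lambda>r. (a (fst (snd r)), fst r)) -
   cent mix (\<lambda>r. g (snd (snd r))) (\<lambda>r. (fst (snd r), fst r)) = pmf_E m (\<lambda>c. rate W a g (k c))"
proof -
  have "rate W (\<lambda>x. x) g p = 0" for p
    by (simp add: rate_def)
  then have "cent mix (\<lambda>r. g (snd (snd r))) (\<lambda>r. (fst (snd r), fst r)) =
      cent avg (\<lambda>w. g (snd w)) fst"
    using rate_mix[where W=W and m=m and k=k and a="\<lambda>x. x" and g=g, OF fin_m fin_k] by simp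
  then show ?thesis
    using rate_mix[where W=W and m=m and k=k and a=a and g=g, OF fin_m fin_k] by simp
qed

text \<open>The pad is independent of the output, so the draws commute and the output can come last,
  after the tags and the input are fixed.\<close>

lemma padded_eq_joint:
  "padded = map_pmf (\<lambda>w. ((fst (fst (fst w)), snd (fst (fst w)), snd w), snd (fst w)))
     (joint (\<lambda>g. W (snd (fst g))) (pair_pmf (bind_pmf m (\<lambda>c. map_pmf (Pair c) (k c))) unif))"
proof -
  have "padded = bind_pmf (bind_pmf m (\<lambda>c. map_pmf (Pair c) (k c)))
      (\<lambda>g. bind_pmf (W (snd g)) (\<lambda>z. bind_pmf unif (\<lambda>u. return_pmf ((fst g, snd g, z), u))))"
    by (simp add: pair_pmf_def joint_def bind_assoc_pmf bind_map_pmf map_bind_pmf map_pmf_comp)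
  also have "\<dots> = bind_pmf (bind_pmf m (\<lambda>c. map_pmf (Pair c) (k c)))
      (\<lambda>g. bind_pmf unif (\<lambda>u. bind_pmf (W (snd g)) (\<lambda>z. return_pmf ((fst g, snd g, z), u))))"
    by (simp only: bind_commute_pmf[of "W _"])
  also have "\<dots> = map_pmf (\<lambda>w. ((fst (fst (fst w)), snd (fst (fst w)), snd w), snd (fst w)))
     (joint (\<lambda>g. W (snd (fst g))) (pair_pmf (bind_pmf m (\<lambda>c. map_pmf (Pair c) (k c))) unif))"
    by (simp add: pair_pmf_def joint_def bind_assoc_pmf bind_return_pmf map_bind_pmf map_pmf_comp
        bind_map_pmf map_pmf_def[symmetric])
  finally show ?thesis .
qed

lemma prob_padded:
  fixes P :: "nat \<Rightarrow> nat \<Rightarrow> bool"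
  shows "measure_pmf.prob padded {w. P (tag1 w) (tag2 N w) \<and> fst (snd (fst w)) = x \<and> snd (snd (fst w)) = z} =
    measure_pmf.prob padded {w. P (tag1 w) (tag2 N w) \<and> fst (snd (fst w)) = x} * pmf (W x) z"
proof -
  let ?G = "pair_pmf (bind_pmf m (\<lambda>c. map_pmf (Pair c) (k c))) unif"
  let ?J = "joint (\<lambda>g. W (snd (fst g))) ?G"
  let ?B = "{g. P (snd g) ((fst (fst g) + snd g) mod N) \<and> snd (fst g) = x}"
  have G: "finite (set_pmf ?G)"
    using fin_m fin_k by auto
  have "measure_pmf.prob padded {w. P (tag1 w) (tag2 N w) \<and> fst (snd (fst w)) = x \<and> snd (snd (fst w)) = z} =
      measure_pmf.prob ?J {w. fst w \<in> ?B \<and> snd w = z}"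
    unfolding padded_eq_joint by (simp add: tag1_def tag2_def vimage_def conj_assoc)
  also have "\<dots> = measure_pmf.prob ?G ?B * pmf (W x) z"
    by (rule prob_joint_rect[OF G]) auto
  also have "measure_pmf.prob ?G ?B = measure_pmf.prob (map_pmf fst ?J) ?B"
    by (simp only: map_fst_joint)
  also have "\<dots> = measure_pmf.prob ?J (fst -` ?B)"
    by (rule measure_map_pmf)
  also have "\<dots> = measure_pmf.prob padded {w. P (tag1 w) (tag2 N w) \<and> fst (snd (fst w)) = x}"
    unfolding padded_eq_joint by (simp add: tag1_def tag2_def vimage_def)
  finally show ?thesis .
qed

end

section \<open>Realisation on the sample space required by \<open>DB_IC\<close>\<close>

type_synonym ('x1, 'x2, 'y1, 'y2, 'f1, 'f2) sample =
  "real \<times> real \<times> 'x1 \<times> 'x2 \<times> 'y1 \<times> 'y2 \<times> 'f1 \<times> 'f2"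

definition tags :: "nat \<Rightarrow> real set" where
  "tags N = real ` {..<N}"

definition tag_space :: "nat \<Rightarrow> real measure" where
  "tag_space N = count_space (tags N)"

text \<open>The auxiliary variables have to map the whole sample space, not only the support of the law,
  into the finite alphabet.\<close>

definition clamp :: "nat \<Rightarrow> real \<Rightarrow> real" where
  "clamp N t = (if t \<in> tags N then t else 0)"

definition T1 :: "nat \<Rightarrow> ('x1, 'x2, 'y1, 'y2, 'f1, 'f2) sample \<Rightarrow> real" where
  "T1 N w = clamp N (fst w)"

definition T2 :: "nat \<Rightarrow> ('x1, 'x2, 'y1, 'y2, 'f1, 'f2) sample \<Rightarrow> real" where
  "T2 N w = clamp N (fst (snd w))"

definition X1 :: "('x1, 'x2, 'y1, 'y2, 'f1, 'f2) sample \<Rightarrow> 'x1" where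
  "X1 w = fst (snd (snd w))"

definition X2 :: "('x1, 'x2, 'y1, 'y2, 'f1, 'f2) sample \<Rightarrow> 'x2" where
  "X2 w = fst (snd (snd (snd w)))"

definition Z :: "('x1, 'x2, 'y1, 'y2, 'f1, 'f2) sample \<Rightarrow> 'y1 \<times> 'y2 \<times> 'f1 \<times> 'f2" where
  "Z w = snd (snd (snd (snd w)))"

definition to_sample :: "nat \<Rightarrow> (nat \<times> ('x1 \<times> 'x2) \<times> 'y1 \<times> 'y2 \<times> 'f1 \<times> 'f2) \<times> nat
    \<Rightarrow> ('x1, 'x2, 'y1, 'y2, 'f1, 'f2) sample" where
  "to_sample N w = (real (tag1 w), real (tag2 N w), fst (fst (snd (fst w))), snd (fst (snd (fst w))),
     snd (snd (fst w)))"

lemma to_sample_simps: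
  "X1 (to_sample N w) = fst (fst (snd (fst w)))" "X2 (to_sample N w) = snd (fst (snd (fst w)))"
  "Z (to_sample N w) = snd (snd (fst w))"
  by (simp_all add: X1_def X2_def Z_def to_sample_def)

lemma finite_tags [simp]: "finite (tags N)"
  by (simp add: tags_def)

lemma Z_iff:
  "out1 (Z w) = y1 \<and> out2 (Z w) = y2 \<and> fb1 (Z w) = f1 \<and> fb2 (Z w) = f2 \<longleftrightarrow> Z w = (y1, y2, f1, f2)"
  by (auto simp: out1_def out2_def fb1_def fb2_def split: prod.splits)

lemma Z_tuples:
  "(\<lambda>w. (out1 (Z w), out2 (Z w), fb2 (Z w))) = (\<lambda>w. outs_fb2 (Z w))"
  "(\<lambda>w. (out1 (Z w), out2 (Z w), fb1 (Z w))) = (\<lambda>w. outs_fb1 (Z w))"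
  "(\<lambda>w. (out1 (Z w), out2 (Z w))) = (\<lambda>w. outs (Z w))"
  "(\<lambda>w. (fb1 (Z w), fb2 (Z w))) = (\<lambda>w. fbs (Z w))"
  "(\<lambda>w. (out1 (Z w), out2 (Z w), fb1 (Z w), fb2 (Z w))) = Z"
  by (auto simp: outs_fb1_def outs_fb2_def outs_def fbs_def out1_def out2_def fb1_def fb2_def
      fun_eq_iff split: prod.splits)

context
  fixes ch :: "('x1::finite, 'x2::finite, 'y1::finite, 'y2::finite, 'f1::finite, 'f2::finite) icgf"
    and m :: "nat pmf" and k :: "nat \<Rightarrow> ('x1 \<times> 'x2) pmf" and N :: nat
  assumes fin_m: "finite (set_pmf m)" and N: "set_pmf m \<subseteq> {..<N}"
begin

lemma fin_k: "finite (set_pmf (k c))"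
  by simp

lemmas pad = fin_m fin_k N

abbreviation "Q \<equiv> map_pmf (to_sample N) (padded (chan ch) m k N)"
abbreviation "P \<equiv> padded (chan ch) m k N"
abbreviation "S \<equiv> tag_space N"

lemma finite_P: "finite (set_pmf P)"
  by (rule finite_padded[where k=k, OF pad])

lemma finite_Q: "finite (set_pmf Q)"
  unfolding set_map_pmf by (rule finite_imageI) (rule finite_P)

lemma T_tags: "T1 N w \<in> tags N" "T2 N w \<in> tags N"
  using N_pos[where k=k, OF pad] by (auto simp: T1_def T2_def clamp_def tags_def)

lemma T_to_sample:
  assumes "w \<in> set_pmf P"
  shows "T1 N (to_sample N w) = real (tag1 w)" "T2 N (to_sample N w) = real (tag2 N w)"
proof -
  have "tag1 w < N" "tag2 N w < N"
    using set_padded[where k=k, OF pad assms] N_pos[where k=k, OF pad] by (auto simp: tag1_def tag2_def)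
  then show "T1 N (to_sample N w) = real (tag1 w)" "T2 N (to_sample N w) = real (tag2 N w)"
    by (auto simp: T1_def T2_def clamp_def to_sample_def tags_def)
qed

lemma tag_products:
  "count_space UNIV \<Otimes>\<^sub>M S = count_space ((UNIV :: 'x1 set) \<times> tags N)"
  "count_space UNIV \<Otimes>\<^sub>M S = count_space ((UNIV :: 'x2 set) \<times> tags N)"
  "S \<Otimes>\<^sub>M S = count_space (tags N \<times> tags N)"
  "count_space UNIV \<Otimes>\<^sub>M (count_space UNIV \<Otimes>\<^sub>M count_space (tags N \<times> tags N)) =
    count_space ((UNIV :: 'f1 set) \<times> (UNIV :: 'f2 set) \<times> tags N \<times> tags N)"
  by (simp_all add: tag_space_def pair_measure_count_space)

lemma cent_Q:
  "cent Q (\<lambda>w. g (Z w)) (\<lambda>w. a (X1 w, X2 w)) =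
   cent (avg (chan ch) m k) (\<lambda>w. g (snd w)) (\<lambda>w. a (fst w))"
proof -
  have "cent Q (\<lambda>w. g (Z w)) (\<lambda>w. a (X1 w, X2 w)) =
      cent P (\<lambda>w. g (snd (snd (fst w)))) (\<lambda>w. a (fst (snd (fst w))))"
    unfolding cent_map by (simp add: to_sample_simps)
  then show ?thesis
    using cent_no_tag[where W="chan ch" and k=k, OF pad, where X="\<lambda>w. g (snd w)" and Y="\<lambda>w. a (fst w)"]
    by simp
qed

lemma cent_Q_T1:
  "cent Q (\<lambda>w. g (Z w)) (\<lambda>w. (a (X1 w, X2 w), T1 N w)) =
   cent (avg (chan ch) m k) (\<lambda>w. g (snd w)) (\<lambda>w. a (fst w))"
proof -
  have "cent Q (\<lambda>w. g (Z w)) (\<lambda>w. (a (X1 w, X2 w), T1 N w)) =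
      cent P (\<lambda>w. g (snd (snd (fst w)))) (\<lambda>w. (a (fst (snd (fst w))), tag1 w))"
    unfolding cent_map
    by (rule cent_eqI) (simp_all add: to_sample_simps T_to_sample del: set_pair_pmf)
  then show ?thesis
    using cent_tag1[where W="chan ch" and k=k, OF pad, where X="\<lambda>w. g (snd w)" and Y="\<lambda>w. a (fst w)"]
    by simp
qed

lemma cent_Q_T2:
  "cent Q (\<lambda>w. g (Z w)) (\<lambda>w. (a (X1 w, X2 w), T2 N w)) =
   cent (avg (chan ch) m k) (\<lambda>w. g (snd w)) (\<lambda>w. a (fst w))"
proof -
  have "cent Q (\<lambda>w. g (Z w)) (\<lambda>w. (a (X1 w, X2 w), T2 N w)) =
      cent P (\<lambda>w. g (snd (snd (fst w)))) (\<lambda>w. (a (fst (snd (fst w))), tag2 N w))"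
    unfolding cent_map
    by (rule cent_eqI) (simp_all add: to_sample_simps T_to_sample del: set_pair_pmf)
  then show ?thesis
    using cent_tag2[where W="chan ch" and k=k, OF pad, where X="\<lambda>w. g (snd w)" and Y="\<lambda>w. a (fst w)"]
    by simp
qed

lemma cent_Q_T12:
  "cent Q (\<lambda>w. g (Z w)) (\<lambda>w. (a (X1 w, X2 w), T1 N w, T2 N w)) =
   cent (mix (chan ch) m k) (\<lambda>r. g (snd (snd r))) (\<lambda>r. (a (fst (snd r)), fst r))"
proof -
  have "cent Q (\<lambda>w. g (Z w)) (\<lambda>w. (a (X1 w, X2 w), T1 N w, T2 N w)) =
      cent P (\<lambda>w. g (snd (snd (fst w)))) (\<lambda>w. (a (fst (snd (fst w))), tag1 w, tag2 N w))"
    unfolding cent_map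
    by (rule cent_eqI) (simp_all add: to_sample_simps T_to_sample del: set_pair_pmf)
  then show ?thesis
    using cent_tags[where W="chan ch" and k=k, OF pad, where X="\<lambda>w. g (snd w)" and Y="\<lambda>w. a (fst w)"]
    by simp
qed

lemma mi_Q:
  fixes g :: "_ \<Rightarrow> 'b::finite"
  shows "mi (measure_pmf Q) (\<lambda>w. (X1 w, X2 w)) (\<lambda>w. g (Z w)) = rate (chan ch) (\<lambda>_. ()) g (bind_pmf m k)"
  unfolding mi_pmf[OF finite_Q]
  using cent_Q[of g "\<lambda>_. ()"] cent_Q[of g "\<lambda>x. x"] by (simp add: rate_def cent_const)

lemma cmi_X1_Q:
  "cmi (measure_pmf Q) (count_space UNIV \<Otimes>\<^sub>M S) X1 (\<lambda>w. outs_fb2 (Z w)) (\<lambda>w. (X2 w, T2 N w)) =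
   rate (chan ch) snd outs_fb2 (bind_pmf m k)"
proof -
  have "cmi (measure_pmf Q) (count_space UNIV \<Otimes>\<^sub>M S) X1 (\<lambda>w. outs_fb2 (Z w)) (\<lambda>w. (X2 w, T2 N w)) =
      cent Q (\<lambda>w. outs_fb2 (Z w)) (\<lambda>w. (X2 w, T2 N w)) -
      cent Q (\<lambda>w. outs_fb2 (Z w)) (\<lambda>w. (X1 w, X2 w, T2 N w))"
    unfolding tag_products by (rule cmi_pmf[OF finite_Q]) (simp_all add: T_tags)
  also have "cent Q (\<lambda>w. outs_fb2 (Z w)) (\<lambda>w. (X1 w, X2 w, T2 N w)) =
      cent Q (\<lambda>w. outs_fb2 (Z w)) (\<lambda>w. ((X1 w, X2 w), T2 N w))"
    by (rule cent_eqI) simp_all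
  finally show ?thesis
    using cent_Q_T2[of outs_fb2 snd] cent_Q_T2[of outs_fb2 "\<lambda>x. x"] by (simp add: rate_def)
qed

lemma cmi_X2_Q:
  "cmi (measure_pmf Q) (count_space UNIV \<Otimes>\<^sub>M S) X2 (\<lambda>w. outs_fb1 (Z w)) (\<lambda>w. (X1 w, T1 N w)) =
   rate (chan ch) fst outs_fb1 (bind_pmf m k)"
proof -
  have "cmi (measure_pmf Q) (count_space UNIV \<Otimes>\<^sub>M S) X2 (\<lambda>w. outs_fb1 (Z w)) (\<lambda>w. (X1 w, T1 N w)) =
      cent Q (\<lambda>w. outs_fb1 (Z w)) (\<lambda>w. (X1 w, T1 N w)) -
      cent Q (\<lambda>w. outs_fb1 (Z w)) (\<lambda>w. (X2 w, X1 w, T1 N w))"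
    unfolding tag_products by (rule cmi_pmf[OF finite_Q]) (simp_all add: T_tags)
  also have "cent Q (\<lambda>w. outs_fb1 (Z w)) (\<lambda>w. (X2 w, X1 w, T1 N w)) =
      cent Q (\<lambda>w. outs_fb1 (Z w)) (\<lambda>w. ((X1 w, X2 w), T1 N w))"
    by (rule cent_eqI) auto
  finally show ?thesis
    using cent_Q_T1[of outs_fb1 fst] cent_Q_T1[of outs_fb1 "\<lambda>x. x"] by (simp add: rate_def)
qed

text \<open>The dummy component fits the shape of \<open>cent_Q_T12\<close> with constant
  \<open>a\<close>.\<close>

lemma cent_Q_T12_unit: "cent Q G (\<lambda>w. (T1 N w, T2 N w)) = cent Q G (\<lambda>w. ((), T1 N w, T2 N w))"
  by (rule cent_eqI) simp_all

lemma cmi_X12_Q: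
  "cmi (measure_pmf Q) (S \<Otimes>\<^sub>M S) (\<lambda>w. (X1 w, X2 w)) Z (\<lambda>w. (T1 N w, T2 N w)) =
   pmf_E m (\<lambda>c. rate (chan ch) (\<lambda>_. ()) (\<lambda>z. z) (k c))"
proof -
  have "cmi (measure_pmf Q) (S \<Otimes>\<^sub>M S) (\<lambda>w. (X1 w, X2 w)) Z (\<lambda>w. (T1 N w, T2 N w)) =
      cent Q Z (\<lambda>w. (T1 N w, T2 N w)) - cent Q Z (\<lambda>w. ((X1 w, X2 w), T1 N w, T2 N w))"
    unfolding tag_products by (rule cmi_pmf[OF finite_Q]) (simp_all add: T_tags)
  then show ?thesis
    unfolding cent_mix_eq_E_rate[where k=k, OF pad, symmetric] cent_Q_T12_unit
    using cent_Q_T12[of "\<lambda>z. z" "\<lambda>_. ()"] cent_Q_T12[of "\<lambda>z. z" "\<lambda>x. x"] by simp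
qed

lemma cmi_balance_Q:
  "cmi (measure_pmf Q) (count_space UNIV \<Otimes>\<^sub>M (count_space UNIV \<Otimes>\<^sub>M (S \<Otimes>\<^sub>M S))) X1 X2
     (\<lambda>w. (fb1 (Z w), fb2 (Z w), T1 N w, T2 N w)) -
   cmi (measure_pmf Q) (S \<Otimes>\<^sub>M S) X1 X2 (\<lambda>w. (T1 N w, T2 N w)) =
   pmf_E m (\<lambda>c. balance (chan ch) fbs (k c))"
proof -
  have "cmi (measure_pmf Q) (count_space UNIV \<Otimes>\<^sub>M (count_space UNIV \<Otimes>\<^sub>M (S \<Otimes>\<^sub>M S))) X1 X2
      (\<lambda>w. (fb1 (Z w), fb2 (Z w), T1 N w, T2 N w)) -
    cmi (measure_pmf Q) (S \<Otimes>\<^sub>M S) X1 X2 (\<lambda>w. (T1 N w, T2 N w)) =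
    cent Q (\<lambda>w. fbs (Z w)) (\<lambda>w. (X1 w, T1 N w, T2 N w)) + cent Q (\<lambda>w. fbs (Z w)) (\<lambda>w. (X2 w, T1 N w, T2 N w)) -
    cent Q (\<lambda>w. fbs (Z w)) (\<lambda>w. ((X1 w, X2 w), T1 N w, T2 N w)) - cent Q (\<lambda>w. fbs (Z w)) (\<lambda>w. (T1 N w, T2 N w))"
    unfolding tag_products Z_tuples(4)[symmetric]
    by (rule cmi_diff_pmf[OF finite_Q]) (simp_all add: T_tags)
  also have "\<dots> = pmf_E m (\<lambda>c. balance (chan ch) fbs (k c))"
    unfolding balance_def cent_Q_T12_unit
    using cent_Q_T12[of fbs fst] cent_Q_T12[of fbs snd] cent_Q_T12[of fbs "\<lambda>x. x"] cent_Q_T12[of fbs "\<lambda>_. ()"]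
    by (simp add: pmf_E_diff pmf_E_add fin_m cent_mix_eq_E_rate[where k=k, OF pad, symmetric])
  finally show ?thesis .
qed

text \<open>Clamping is inactive on the support, so both events agree almost surely.\<close>

lemma prob_Q:
  "measure_pmf.prob Q {w. R (T1 N w) (T2 N w) (X1 w) (X2 w) (Z w)} =
   measure_pmf.prob P {w. R (real (tag1 w)) (real (tag2 N w)) (fst (fst (snd (fst w))))
      (snd (fst (snd (fst w)))) (snd (snd (fst w)))}"
  unfolding measure_map_pmf vimage_def mem_Collect_eq to_sample_simps
  by (rule measure_pmf.finite_measure_eq_AE)
     (auto simp: AE_measure_pmf_iff T_to_sample simp del: set_pair_pmf)

lemma prob_Q_channel:
  "measure_pmf.prob Q {w. (T1 N w, T2 N w) \<in> B \<and> X1 w = x1 \<and> X2 w = x2 \<and> Z w = z} =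
   measure_pmf.prob Q {w. (T1 N w, T2 N w) \<in> B \<and> X1 w = x1 \<and> X2 w = x2} * pmf (ch x1 x2) z"
proof -
  have "measure_pmf.prob Q {w. (T1 N w, T2 N w) \<in> B \<and> X1 w = x1 \<and> X2 w = x2 \<and> Z w = z} =
      measure_pmf.prob P {w. (real (tag1 w), real (tag2 N w)) \<in> B \<and> fst (snd (fst w)) = (x1, x2) \<and> snd (snd (fst w)) = z}"
    by (subst prob_Q[of "\<lambda>t1 t2 a b y. (t1, t2) \<in> B \<and> a = x1 \<and> b = x2 \<and> y = z"])
       (simp add: prod_eq_iff conj_assoc)
  also have "\<dots> = measure_pmf.prob P {w. (real (tag1 w), real (tag2 N w)) \<in> B \<and> fst (snd (fst w)) = (x1, x2)} * pmf (ch x1 x2) z"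
    by (subst prob_padded[where k=k, OF pad, where P="\<lambda>t1 t2. (real t1, real t2) \<in> B"]) (simp add: chan_def)
  also have "measure_pmf.prob P {w. (real (tag1 w), real (tag2 N w)) \<in> B \<and> fst (snd (fst w)) = (x1, x2)} =
      measure_pmf.prob Q {w. (T1 N w, T2 N w) \<in> B \<and> X1 w = x1 \<and> X2 w = x2}"
    by (subst prob_Q[of "\<lambda>t1 t2 a b y. (t1, t2) \<in> B \<and> a = x1 \<and> b = x2"]) (simp add: prod_eq_iff)
  finally show ?thesis .
qed

lemma channel_variables_Q:
  "channel_variables ch (measure_pmf Q) S S (T1 N) (T2 N) X1 X2
     (\<lambda>w. out1 (Z w)) (\<lambda>w. out2 (Z w)) (\<lambda>w. fb1 (Z w)) (\<lambda>w. fb2 (Z w))"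
  unfolding channel_variables_def Z_iff
  using prob_Q_channel by (simp add: tag_space_def measure_pmf.prob_space_axioms T_tags)

lemma padded_in_DB_IC:
  assumes R: "0 \<le> R1" "0 \<le> R2"
    and R1_out: "R1 \<le> rate (chan ch) (\<lambda>_. ()) out1 (bind_pmf m k)"
    and R2_out: "R2 \<le> rate (chan ch) (\<lambda>_. ()) out2 (bind_pmf m k)"
    and R1_all: "R1 \<le> rate (chan ch) snd outs_fb2 (bind_pmf m k)"
    and R2_all: "R2 \<le> rate (chan ch) fst outs_fb1 (bind_pmf m k)"
    and sum_all: "R1 + R2 \<le> pmf_E m (\<lambda>c. rate (chan ch) (\<lambda>_. ()) (\<lambda>z. z) (k c))"
    and sum_out: "R1 + R2 \<le> rate (chan ch) (\<lambda>_. ()) outs (bind_pmf m k)"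
    and bal: "0 \<le> pmf_E m (\<lambda>c. balance (chan ch) fbs (k c))"
  shows "(R1, R2) \<in> DB_IC ch"
  unfolding DB_IC_def mem_Collect_eq prod.case
  \<comment> \<open>The channel condition is resolved before the bounds because it instantiates the
    existential witnesses.\<close>
  by (intro conjI exI, rule R(1), rule R(2), rule channel_variables_Q, unfold Z_tuples mi_Q cmi_X1_Q cmi_X2_Q cmi_X12_Q)
     (use assms(3-) cmi_balance_Q in simp_all)

end

subsection \<open>The outer bound\<close>

theorem theorem2:
  fixes ch :: "('x1::finite, 'x2::finite, 'y1::finite, 'y2::finite, 'f1::finite, 'f2::finite) icgf"
  shows "capacity_region ch \<subseteq> DB_IC ch"
proof (rule subrelI)
  fix R1 R2 assume cap: "(R1, R2) \<in> capacity_region ch"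
  obtain v where v: "v \<in> convex hull range (profile (chan ch) fbs)"
    and bounds: "R1 \<le> rateV (chan ch) (\<lambda>_. ()) out1 (fst v)" "R2 \<le> rateV (chan ch) (\<lambda>_. ()) out2 (fst v)"
      "R1 \<le> rateV (chan ch) snd outs_fb2 (fst v)" "R2 \<le> rateV (chan ch) fst outs_fb1 (fst v)"
      "R1 + R2 \<le> fst (snd v)" "R1 + R2 \<le> rateV (chan ch) (\<lambda>_. ()) outs (fst v)" "0 \<le> snd (snd v)"
    by (rule capacity_region_point[OF cap])
  obtain m :: "nat pmf" and k where m: "finite (set_pmf m)"
    and v_eq: "v = (pvec (bind_pmf m k), pmf_E m (\<lambda>c. rate (chan ch) (\<lambda>_. ()) (\<lambda>z. z) (k c)),
      pmf_E m (\<lambda>c. balance (chan ch) fbs (k c)))"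
    by (rule hull_is_mix[OF v])
  \<comment> \<open>Any modulus exceeding the finitely many labels would serve.\<close>
  have "set_pmf m \<subseteq> {..<Suc (Max (set_pmf m))}"
    using m by (auto simp: less_Suc_eq_le)
  then show "(R1, R2) \<in> DB_IC ch"
    by (rule padded_in_DB_IC[OF m])
       (fact capacity_region_nonneg[OF cap] bounds[unfolded v_eq fst_conv snd_conv rate_eq_rateV[symmetric]])+
qed

end
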